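(* Let $n,m\ge1$ be integers, let $g_1,\dots,g_m\in\mathbb{R}[\bar z,z]$ be real-valued complex polynomials on $\mathbb{C}^n$ of respective degrees $k_1,\dots,k_m$, let $K=\{z\in\mathbb{C}^n : g_i(z)\ge0,\ i=1,\dots,m\}$ be compact, let $d_K:=\max_{1\le i\le m}k_i$ and $d\ge d_K$. Let $y\in\mathcal{H}_d$ be a Hankel matrix, i.e. $y_{\alpha,\beta}=y_{\gamma,\delta}$ for all $|\alpha|,|\beta|,|\gamma|,|\delta|\le d$ such that $\alpha+\beta=\gamma+\delta$. Then there exists a positive $\operatorname{rank}M_{d-d_K}(y)$-atomic measure $\mu$ supported on $K$ such that $$y_{\alpha,\beta}=\int_{\mathbb{C}^n}\bar z^\alpha z^\beta\,d\mu\qquad\text{for all }|\alpha|,|\beta|\le d$$ if and only if: 1. $M_d(y)\succcurlyeq0$ and $M_{d-d_K}(g_iy)\succcurlyeq0$ for $i=1,\dots,m$; 2. $\operatorname{rank}M_d(y)=\operatorname{rank}M_{d-d_K}(y)$. Moreover, for each $1\le i\le m$, the measure $\mu$ has exactly $\operatorname{rank}M_d(y)-\operatorname{rank}M_{d-d_K}(g_iy)$ atoms that are zeros of $g_i$.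
   Context: For $z\in\mathbb{C}^n$, $\alpha\in\mathbb{N}^n$: $z^\alpha=z_1^{\alpha_1}\cdots z_n^{\alpha_n}$, $|\alpha|=\alpha_1+\dots+\alpha_n$. $\mathbb{R}_l[\bar z,z]$ is the set of functions $\sum_{|\alpha|,|\beta|\le l}\varphi_{\alpha,\beta}\bar z^\alpha z^\beta$ ($\varphi_{\alpha,\beta}\in\mathbb{C}$) that are real-valued on $\mathbb{C}^n$; $\mathbb{R}[\bar z,z]=\bigcup_l\mathbb{R}_l[\bar z,z]$. The degree $k_i$ of $g_i$ means: $g_i\in\mathbb{R}_{k_i}[\bar z,z]$ and there exist $|\alpha|=k_i$, $|\beta|\le k_i$ with $g_{i,\alpha,\beta}\ne0$. $\mathcal{H}_d$ is the set of complex families $y=(y_{\alpha,\beta})_{|\alpha|,|\beta|\le d}$ (multi-indices in $\mathbb{N}^n$) with $\overline{y_{\alpha,\beta}}=y_{\beta,\alpha}$. For $\varphi=\sum\varphi_{\gamma,\delta}\bar z^\gamma z^\delta$, $M_t(\varphi y)$ is the matrix indexed by $|\alpha|,|\beta|\le t$ with entries $M_t(\varphi y)(\alpha,\beta)=\sum_{\gamma,\delta}\varphi_{\gamma,\delta}\,y_{\alpha+\gamma,\beta+\delta}$, and $M_t(y)=(y_{\alpha,\beta})_{|\alpha|,|\beta|\le t}$. A positive $r$-atomic measure is a measure $\sum_{j=1}^r\lambda_j\delta_{z(j)}$ with $\lambda_j>0$ and distinct points (atoms) $z(j)$. $\succcurlyeq0$ means Hermitian positive semidefinite. *)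

theory Defs
  imports
    "HOL-Probability.Giry_Monad"
    "HOL-Library.Function_Algebras"
    "HOL-Library.Poly_Mapping"
begin

type_synonym 'n multi = "nat ^ 'n"

definition mdeg :: "'n::finite multi \<Rightarrow> nat" where
  "mdeg \<alpha> = (\<Sum>i\<in>UNIV. \<alpha> $ i)"

definition midx :: "nat \<Rightarrow> 'n::finite multi set" where
  "midx t = {\<alpha>. mdeg \<alpha> \<le> t}"

definition mpow :: "complex ^ 'n \<Rightarrow> 'n::finite multi \<Rightarrow> complex" where
  "mpow z \<alpha> = (\<Prod>i\<in>UNIV. (z $ i) ^ (\<alpha> $ i))"

text \<open>
  A polynomial in the conjugated variables and the variables is given by its coefficients: the key
  \<open>(\<alpha>, \<beta>)\<close> stands for the monomial with exponent \<open>\<alpha>\<close> on the conjugated and \<open>\<beta>\<close> on the plain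
  variables. These monomials are linearly independent functions on complex n-space, so such
  coefficient families correspond one-to-one to the polynomial functions.
\<close>

type_synonym 'n cpoly = "('n multi \<times> 'n multi) \<Rightarrow>\<^sub>0 complex"

definition ceval :: "'n::finite cpoly \<Rightarrow> complex ^ 'n \<Rightarrow> complex" where
  "ceval \<phi> z = (\<Sum>(\<alpha>, \<beta>)\<in>Poly_Mapping.keys \<phi>.
     Poly_Mapping.lookup \<phi> (\<alpha>, \<beta>) * cnj (mpow z \<alpha>) * mpow z \<beta>)"

definition real_cpolys :: "nat \<Rightarrow> 'n::finite cpoly set" where
  "real_cpolys l =
     {\<phi>. Poly_Mapping.keys \<phi> \<subseteq> midx l \<times> midx l \<and> (\<forall>z. ceval \<phi> z \<in> \<real>)}"

text \<open>No \<open>k\<close> is a degree of the zero polynomial.\<close>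

definition has_cdegree :: "'n::finite cpoly \<Rightarrow> nat \<Rightarrow> bool" where
  "has_cdegree \<phi> k \<longleftrightarrow> \<phi> \<in> real_cpolys k \<and>
     (\<exists>\<alpha> \<beta>. mdeg \<alpha> = k \<and> mdeg \<beta> \<le> k \<and> Poly_Mapping.lookup \<phi> (\<alpha>, \<beta>) \<noteq> 0)"

text \<open>
  The values of a polynomial with \<open>has_cdegree\<close> are real, so \<open>Re\<close> only changes the type.
\<close>

definition feasible_set :: "nat \<Rightarrow> (nat \<Rightarrow> 'n::finite cpoly) \<Rightarrow> (complex ^ 'n) set" where
  "feasible_set m g = {z. \<forall>i\<in>{1..m}. Re (ceval (g i) z) \<ge> 0}"

text \<open>
  Families indexed by pairs of multi-indices are total functions; only the entries with both
  indices in \<open>midx d\<close> are constrained, and only those are used below.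
\<close>

definition herm_families :: "nat \<Rightarrow> ('n::finite multi \<Rightarrow> 'n multi \<Rightarrow> complex) set" where
  "herm_families d = {y. \<forall>\<alpha>\<in>midx d. \<forall>\<beta>\<in>midx d. cnj (y \<alpha> \<beta>) = y \<beta> \<alpha>}"

definition hankel :: "nat \<Rightarrow> ('n::finite multi \<Rightarrow> 'n multi \<Rightarrow> complex) \<Rightarrow> bool" where
  "hankel d y \<longleftrightarrow>
     (\<forall>\<alpha>\<in>midx d. \<forall>\<beta>\<in>midx d. \<forall>\<gamma>\<in>midx d. \<forall>\<delta>\<in>midx d.
        \<alpha> + \<beta> = \<gamma> + \<delta> \<longrightarrow> y \<alpha> \<beta> = y \<gamma> \<delta>)"

text \<open>
  The entries of the localizing matrix of \<open>\<phi>\<close>. The truncation order \<open>t\<close> enters through the index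
  set \<open>midx t\<close> passed to \<open>mat_psd\<close> and \<open>mat_rank\<close>; the moment matrix itself has the entries \<open>y\<close>.
\<close>

definition localize ::
  "'n::finite cpoly \<Rightarrow> ('n multi \<Rightarrow> 'n multi \<Rightarrow> complex) \<Rightarrow> 'n multi \<Rightarrow> 'n multi \<Rightarrow> complex" where
  "localize \<phi> y \<alpha> \<beta> = (\<Sum>(\<gamma>, \<delta>)\<in>Poly_Mapping.keys \<phi>.
     Poly_Mapping.lookup \<phi> (\<gamma>, \<delta>) * y (\<alpha> + \<gamma>) (\<beta> + \<delta>))"

definition mat_psd :: "'a set \<Rightarrow> ('a \<Rightarrow> 'a \<Rightarrow> complex) \<Rightarrow> bool" where
  "mat_psd I A \<longleftrightarrow>
     (\<forall>a\<in>I. \<forall>b\<in>I. A b a = cnj (A a b)) \<and>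
     (\<forall>v. Re (\<Sum>a\<in>I. \<Sum>b\<in>I. cnj (v a) * A a b * v b) \<ge> 0)"

global_interpretation cfun: vector_space "\<lambda>(c::complex) (v::'a \<Rightarrow> complex) a. c * v a"
  by unfold_locales (auto simp: fun_eq_iff algebra_simps)

text \<open>
  Column rank of the matrix with rows and columns indexed by \<open>I\<close>; columns are extended by zero
  outside \<open>I\<close>, so that entries outside \<open>I \<times> I\<close> play no role.
\<close>

definition mat_rank :: "'a set \<Rightarrow> ('a \<Rightarrow> 'a \<Rightarrow> complex) \<Rightarrow> nat" where
  "mat_rank I A = cfun.dim ((\<lambda>b a. if a \<in> I then A a b else 0) ` I)"

definition atomic_measure :: "nat \<Rightarrow> 'a::topological_space measure \<Rightarrow> bool" where
  "atomic_measure r \<mu> \<longleftrightarrow> sets \<mu> = sets borel \<and>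
     (\<exists>(w :: nat \<Rightarrow> real) x. (\<forall>j<r. w j > 0) \<and> inj_on x {..<r} \<and>
        (\<forall>A\<in>sets borel. emeasure \<mu> A = (\<Sum>j<r. ennreal (w j) * emeasure (return borel (x j)) A)))"

definition atoms :: "'a measure \<Rightarrow> 'a set" where
  "atoms \<mu> = {x. emeasure \<mu> {x} > 0}"

definition represents ::
  "(complex ^ 'n) measure \<Rightarrow> nat \<Rightarrow> ('n::finite multi \<Rightarrow> 'n multi \<Rightarrow> complex) \<Rightarrow> bool" where
  "represents \<mu> d y \<longleftrightarrow>
     (\<forall>\<alpha>\<in>midx d. \<forall>\<beta>\<in>midx d. y \<alpha> \<beta> = (\<integral>z. cnj (mpow z \<alpha>) * mpow z \<beta> \<partial>\<mu>))"

end

theory Submission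
  imports Defs "HOL-Computational_Algebra.Fundamental_Theorem_Algebra"
begin

text \<open>
  Let \<open>t = d - dK\<close>. A Hermitian Hankel family is real and depends only on the sum of its indices, so
  by flatness the shifts \<open>h \<mapsto> (a \<mapsto> h (a + e i))\<close> are well-defined commuting operators on the column
  space of the moment matrix, self-adjoint for the form that it carries. A common eigenvector is a
  multiple of the evaluation vector \<open>a \<mapsto> mpow x a\<close> at a real point \<open>x\<close>. Subtracting this atom with
  the largest weight that preserves positivity keeps the Hankel and flatness properties and lowers the
  rank, so induction on the rank expresses \<open>y\<close> by finitely many atoms, together with polynomials of
  degree at most \<open>t\<close> that interpolate at them. Testing the localizing matrices on these polynomials
  shows that the atoms lie in \<open>K\<close>.

  Conversely, as many atoms as the rank of the truncated moment matrix admit interpolation in degree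
  \<open>t\<close>; then the rank of a localizing matrix is the number of atoms at which \<open>g i\<close> does not vanish.
\<close>

section \<open>Common eigenvectors in spaces of functions\<close>

text \<open>The ambient function space may be infinite-dimensional, where \<open>cfun.dim\<close>
  degenerates to 0. Enclosing \<open>S\<close> in the span of a finite \<open>B\<close> makes its
  basis \<open>D\<close> finite, so \<open>card D\<close> is a genuine bound.\<close>

lemma cfun_dim_mono:
  assumes "finite B" "S \<subseteq> cfun.span B" "R \<subseteq> cfun.span S"
  shows "cfun.dim R \<le> cfun.dim S"
proof -
  obtain D where D: "D \<subseteq> S" "cfun.independent D" "S \<subseteq> cfun.span D" "card D = cfun.dim S"
    by (rule cfun.basis_exists)
  have "finite D"
    using cfun.independent_span_bound[OF assms(1) D(2)] D(1) assms(2) by auto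
  moreover have "R \<subseteq> cfun.span D"
    using assms(3) D(3) cfun.span_mono cfun.span_span by blast
  ultimately show ?thesis
    using cfun.dim_le_card D(4) by metis
qed

text \<open>A vector of \<open>S\<close> outside the span of \<open>R\<close> would extend a basis
  of \<open>R\<close> to an independent family too large for \<open>S\<close>.\<close>

lemma cfun_span_eq_of_dim_le:
  assumes "finite B" "S \<subseteq> cfun.span B" "R \<subseteq> S" "cfun.dim S \<le> cfun.dim R"
  shows "S \<subseteq> cfun.span R"
proof
  fix v assume v: "v \<in> S"
  obtain D where D: "D \<subseteq> R" "cfun.independent D" "R \<subseteq> cfun.span D" "card D = cfun.dim R"
    by (rule cfun.basis_exists)
  have finD: "finite D"
    using cfun.independent_span_bound[OF assms(1) D(2)] D(1) assms(2,3) by auto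
  show "v \<in> cfun.span R"
  proof (rule ccontr)
    assume nv: "v \<notin> cfun.span R"
    then have "v \<notin> cfun.span D"
      using D(1) cfun.span_mono by blast
    then have ind: "cfun.independent (insert v D)" and "v \<notin> D"
      using D(2) cfun.independent_insertI cfun.span_base by blast+
    have "card (insert v D) \<le> cfun.dim (insert v D)"
      using ind by (simp add: cfun.dim_eq_card_independent)
    also have "\<dots> \<le> cfun.dim S"
      by (rule cfun_dim_mono[OF assms(1,2)])
        (use v D(1) assms(3) cfun.span_superset in blast)
    finally show False
      using \<open>v \<notin> D\<close> finD D(4) assms(4) by simp
  qed
qed

text \<open>The coefficients are indexed by \<open>J\<close> and not by the vectors, because
  different indices may carry the same column.\<close>

lemma cfun_image_span:
  "h \<in> cfun.span (c ` J) \<Longrightarrow> finite J \<Longrightarrow> \<exists>p. h = (\<lambda>a. \<Sum>b\<in>J. p b * c b a)"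
proof (induction rule: cfun.span_induct_alt)
  case base
  then show ?case by (intro exI[of _ "\<lambda>_. 0"]) (simp add: zero_fun_def)
next
  case (step k x h)
  then obtain p b where p: "h = (\<lambda>a. \<Sum>b\<in>J. p b * c b a)" and b: "b \<in> J" "x = c b"
    by blast
  have "(\<lambda>a. k * x a) + h = (\<lambda>a. \<Sum>e\<in>J. (if e = b then k + p e else p e) * c e a)"
  proof
    fix a
    have "(\<Sum>e\<in>J. (if e = b then k + p e else p e) * c e a)
      = (\<Sum>e\<in>J. (if e = b then k * c e a else 0) + p e * c e a)"
      by (rule sum.cong) (auto simp: algebra_simps)
    then show "((\<lambda>a. k * x a) + h) a = (\<Sum>e\<in>J. (if e = b then k + p e else p e) * c e a)"
      using step.prems b by (simp add: p sum.distrib)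
  qed
  then show ?case by metis
qed

lemma cfun_sum_in_span:
  assumes "\<And>b. b \<in> J \<Longrightarrow> c b \<in> cfun.span S"
  shows "(\<lambda>a. \<Sum>b\<in>J. p b * c b a) \<in> cfun.span S"
proof (cases "finite J")
  case True
  have "(\<lambda>a. \<Sum>b\<in>J. p b * c b a) = (\<Sum>b\<in>J. (\<lambda>a. p b * c b a))"
    using True by induction (simp_all add: zero_fun_def fun_eq_iff)
  then show ?thesis
    using assms by (simp add: cfun.span_sum cfun.span_scale)
next
  case False
  then show ?thesis using cfun.span_zero[of S] by (simp add: zero_fun_def)
qed

text \<open>Cyclic vector argument: by finite dimension some nonzero polynomial in \<open>T\<close>
  annihilates \<open>w\<close>. Take one of least degree and split off a root \<open>a\<close>; the
  cofactor still maps \<open>w\<close> to a nonzero vector, which \<open>T - a\<close>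
  kills.\<close>

lemma cfun_eigenvector:
  fixes T :: "('a \<Rightarrow> complex) \<Rightarrow> 'a \<Rightarrow> complex"
  assumes W: "cfun.subspace W" and B: "finite B" "W \<subseteq> cfun.span B"
    and w: "w \<in> W" "w \<noteq> 0"
    and T_in: "\<And>h. h \<in> W \<Longrightarrow> T h \<in> W"
    and T_add: "\<And>h k. h \<in> W \<Longrightarrow> k \<in> W \<Longrightarrow> T (h + k) = T h + T k"
    and T_scale: "\<And>c h. h \<in> W \<Longrightarrow> T (\<lambda>x. c * h x) = (\<lambda>x. c * T h x)"
  shows "\<exists>h\<in>W. h \<noteq> 0 \<and> (\<exists>a. T h = (\<lambda>x. a * h x))"
proof -
  \<comment> \<open>\<open>P p\<close> is the vector p(T) w, computed by Horner's scheme.\<close>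
  define P :: "complex poly \<Rightarrow> 'a \<Rightarrow> complex"
    where "P p = fold_coeffs (\<lambda>c h. (\<lambda>x. c * w x) + T h) p 0" for p
  have T0: "T 0 = 0"
    using T_scale[OF w(1), of 0] by (simp add: zero_fun_def)
  have P0: "P 0 = 0" by (simp add: P_def)
  \<comment> \<open>\<open>T 0 = 0\<close> makes the recursion true also for
    \<open>pCons 0 0\<close>, which is the zero polynomial.\<close>
  have P_pCons: "P (pCons c p) = (\<lambda>x. c * w x) + T (P p)" for c p
    by (cases "p = 0"; cases "c = 0") (auto simp: P_def T0 fun_eq_iff)
  have P_in: "P p \<in> W" for p
  proof (induction p)
    case 0
    then show ?case using cfun.subspace_0[OF W] by (simp only: P0)
  next
    case (pCons c p)
    show ?case
      unfolding P_pCons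
      by (rule cfun.subspace_add[OF W cfun.subspace_scale[OF W w(1)] T_in[OF pCons.IH]])
  qed
  have P_add: "P (p + q) = P p + P q" for p q
  proof (induction p q rule: poly_induct2)
    case (pCons c p b q)
    show ?case
      unfolding add_pCons P_pCons pCons.IH T_add[OF P_in P_in] by (simp add: fun_eq_iff algebra_simps)
  qed (simp add: P0)
  have P_smult: "P (smult c p) = (\<lambda>x. c * P p x)" for c p
  proof (induction p)
    case 0
    show ?case unfolding smult_0_right P0 by (simp add: zero_fun_def)
  next
    case (pCons b p)
    have "T (P (smult c p)) = (\<lambda>x. c * T (P p) x)"
      unfolding pCons.IH by (rule T_scale[OF P_in])
    then show ?case
      by (simp only: smult_pCons P_pCons plus_fun_def distrib_left mult.assoc)
  qed
  have P_sum: "P (sum f A) = (\<Sum>i\<in>A. P (f i))" for A and f :: "nat \<Rightarrow> _"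
    by (induction A rule: infinite_finite_induct) (auto simp: P0 P_add)
  have "\<exists>p. p \<noteq> 0 \<and> P p = 0"
  proof (rule ccontr)
    assume contr: "\<nexists>p. p \<noteq> 0 \<and> P p = 0"
    define N where "N = card B"
    define e where "e k = P (monom 1 k)" for k
    \<comment> \<open>Independence concerns the set of the vectors \<open>e k\<close>, so coinciding
      powers must be excluded first; they would already yield an annihilating difference of two
      monomials.\<close>
    have inj: "inj_on e {..N}"
    proof (rule inj_onI)
      fix k l assume "e k = e l"
      then have "P (monom 1 k + smult (- 1) (monom 1 l)) = 0"
        unfolding P_add P_smult e_def by (simp add: fun_eq_iff)
      then have "monom 1 k + smult (- 1) (monom 1 l) = (0 :: complex poly)"
        using contr by blast
      then show "k = l" by (simp add: monom_eq_iff')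
    qed
    have "cfun.independent (e ` {..N})"
    proof
      assume "cfun.dependent (e ` {..N})"
      then obtain u where u: "\<exists>v\<in>e ` {..N}. u v \<noteq> 0" "(\<Sum>v\<in>e ` {..N}. (\<lambda>x. u v * v x)) = 0"
        using cfun.dependent_finite by blast
      define p where "p = (\<Sum>k\<le>N. smult (u (e k)) (monom 1 k))"
      have "P p = (\<Sum>k\<le>N. (\<lambda>x. u (e k) * e k x))"
        by (simp add: p_def P_sum P_smult e_def)
      also have "\<dots> = 0"
        using u(2) by (simp add: sum.reindex[OF inj])
      finally have "p = 0" using contr by blast
      obtain k where k: "k \<le> N" "u (e k) \<noteq> 0" using u(1) by auto
      have "coeff p k = u (e k)"
        using k by (simp add: p_def coeff_sum if_distrib cong: if_cong)
      then show False using k \<open>p = 0\<close> by simp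
    qed
    moreover have "e ` {..N} \<subseteq> cfun.span B"
      using P_in B(2) by (auto simp: e_def)
    ultimately have "card (e ` {..N}) \<le> N"
      using cfun.independent_span_bound[OF B(1)] N_def by blast
    then show False by (simp add: card_image[OF inj])
  qed
  then obtain p where p: "p \<noteq> 0" "P p = 0"
    and p_min: "\<And>q. q \<noteq> 0 \<Longrightarrow> P q = 0 \<Longrightarrow> degree p \<le> degree q"
    using arg_min_nat_lemma[of "\<lambda>p. p \<noteq> 0 \<and> P p = 0" _ degree] by blast
  \<comment> \<open>A nonzero constant only rescales \<open>w\<close> and cannot annihilate
    it.\<close>
  have "degree p \<noteq> 0"
  proof
    assume "degree p = 0"
    then obtain c where "p = [:c:]" using degree_eq_zeroE by blast
    then show False using p w(2) by (auto simp: P_pCons P0 T0 fun_eq_iff)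
  qed
  then obtain a where "poly p a = 0"
    using fundamental_theorem_of_algebra[of p] constant_degree by metis
  then obtain q where q: "p = [:- a, 1:] * q"
    using poly_eq_0_iff_dvd by blast
  with p have q0: "q \<noteq> 0" by auto
  have "degree p = Suc (degree q)" unfolding q using q0 by (subst degree_mult_eq) auto
  then have nz: "P q \<noteq> 0" using p_min[OF q0] by auto
  have "p = pCons 0 q + smult (- a) q" by (simp add: q)
  then have "P p = T (P q) + (\<lambda>x. - a * P q x)"
    by (simp only: P_add P_smult P_pCons) (simp add: fun_eq_iff)
  then have "T (P q) = (\<lambda>x. a * P q x)"
    using p(2) by (simp add: fun_eq_iff add_eq_0_iff)
  with nz P_in show ?thesis by blast
qed

text \<open>Minimising the dimension of an invariant subspace treats all operators at once, whatever
  the index type. Linearity and commutation are asked on \<open>C\<close> only, which suits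
  operators defined through chosen coefficients.\<close>

lemma cfun_common_eigenvector:
  fixes T :: "'i \<Rightarrow> ('a \<Rightarrow> complex) \<Rightarrow> 'a \<Rightarrow> complex"
  assumes C: "cfun.subspace C" and B: "finite B" "C \<subseteq> cfun.span B"
    and w: "w \<in> C" "w \<noteq> 0"
    and T_in: "\<And>i h. h \<in> C \<Longrightarrow> T i h \<in> C"
    and T_add: "\<And>i h k. h \<in> C \<Longrightarrow> k \<in> C \<Longrightarrow> T i (h + k) = T i h + T i k"
    and T_scale: "\<And>i c h. h \<in> C \<Longrightarrow> T i (\<lambda>x. c * h x) = (\<lambda>x. c * T i h x)"
    and T_comm: "\<And>i j h. h \<in> C \<Longrightarrow> T i (T j h) = T j (T i h)"
  shows "\<exists>h\<in>C. h \<noteq> 0 \<and> (\<forall>i. \<exists>a. T i h = (\<lambda>x. a * h x))"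
proof -
  define inv where "inv W \<longleftrightarrow> cfun.subspace W \<and> W \<subseteq> C \<and> W \<noteq> {0} \<and> (\<forall>i. \<forall>h\<in>W. T i h \<in> W)" for W
  have "inv C" using C w T_in by (auto simp: inv_def)
  \<comment> \<open>On a minimal invariant subspace every operator is scalar, since its eigenspaces are invariant.\<close>
  then obtain W where W: "inv W" and W_min: "\<And>V. inv V \<Longrightarrow> cfun.dim W \<le> cfun.dim V"
    using arg_min_nat_lemma[of inv C cfun.dim] by blast
  have sub: "cfun.subspace W" and WC: "W \<subseteq> C" and W_in: "\<And>i h. h \<in> W \<Longrightarrow> T i h \<in> W"
    using W by (auto simp: inv_def)
  have WB: "W \<subseteq> cfun.span B" using WC B by blast
  obtain h where h: "h \<in> W" "h \<noteq> 0"
    using W cfun.subspace_0[OF sub] by (auto simp: inv_def)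
  have "\<exists>a. T i h = (\<lambda>x. a * h x)" for i
  proof -
    have "\<exists>h\<in>W. h \<noteq> 0 \<and> (\<exists>a. T i h = (\<lambda>x. a * h x))"
      by (rule cfun_eigenvector[OF sub B(1) WB h]) (use W_in WC T_add T_scale in \<open>auto simp: subset_iff\<close>)
    then obtain e a where e: "e \<in> W" "e \<noteq> 0" "T i e = (\<lambda>x. a * e x)" by blast
    define V where "V = {k \<in> W. T i k = (\<lambda>x. a * k x)}"
    have VW: "V \<subseteq> W" by (auto simp: V_def)
    have subV: "cfun.subspace V"
    proof (rule cfun.subspaceI)
      have "T i 0 = 0"
        using T_scale[OF w(1), of i 0] by (simp add: zero_fun_def)
      then show "0 \<in> V" using cfun.subspace_0[OF sub] by (auto simp: V_def fun_eq_iff)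
    next
      fix k l assume "k \<in> V" "l \<in> V"
      then show "k + l \<in> V"
        using WC T_add[of k l i] cfun.subspace_add[OF sub]
        by (auto simp: V_def fun_eq_iff distrib_left subset_iff)
    next
      fix c k assume "k \<in> V"
      then have k: "k \<in> W" "k \<in> C" "T i k = (\<lambda>x. a * k x)"
        using WC by (auto simp: V_def)
      show "(\<lambda>x. c * k x) \<in> V"
        using T_scale[OF k(2), of i c] cfun.subspace_scale[OF sub k(1), of c]
        by (simp add: V_def k(3) mult.left_commute)
    qed
    have "T j k \<in> V" if "k \<in> V" for j k
    proof -
      have k: "k \<in> W" "k \<in> C" "T i k = (\<lambda>x. a * k x)"
        using that WC by (auto simp: V_def)
      have "T i (T j k) = (\<lambda>x. a * T j k x)"
        unfolding T_comm[OF k(2), of i j] k(3) by (rule T_scale[OF k(2)])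
      then show ?thesis using W_in k(1) by (simp add: V_def)
    qed
    moreover have "e \<in> V" using e by (simp add: V_def)
    ultimately have "inv V"
      using subV VW WC e(2) by (auto simp: inv_def)
    from W_min[OF this] have "W \<subseteq> cfun.span V"
      by (rule cfun_span_eq_of_dim_le[OF B(1) WB VW])
    then have "h \<in> V"
      using h(1) subV cfun.span_eq_iff by blast
    then show ?thesis by (auto simp: V_def)
  qed
  then show ?thesis using h WC by blast
qed

section \<open>Positive semidefinite forms and columns\<close>

definition matcol :: "'a set \<Rightarrow> ('a \<Rightarrow> 'a \<Rightarrow> complex) \<Rightarrow> 'a \<Rightarrow> 'a \<Rightarrow> complex" where
  "matcol I A b = (\<lambda>a. if a \<in> I then A a b else 0)"

definition mform :: "'a set \<Rightarrow> ('a \<Rightarrow> 'a \<Rightarrow> complex) \<Rightarrow> ('a \<Rightarrow> complex) \<Rightarrow> ('a \<Rightarrow> complex) \<Rightarrow> complex"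
  where "mform I A p q = (\<Sum>a\<in>I. \<Sum>b\<in>I. cnj (p a) * A a b * q b)"

lemma mat_rank_matcol: "mat_rank I A = cfun.dim (matcol I A ` I)"
  unfolding mat_rank_def matcol_def ..

lemma mform_row: "mform I A p q = (\<Sum>a\<in>I. cnj (p a) * (\<Sum>b\<in>I. A a b * q b))"
  by (simp add: mform_def sum_distrib_left mult.assoc)

lemma mat_psd_nonneg: "mat_psd I A \<Longrightarrow> Re (mform I A p p) \<ge> 0"
  unfolding mat_psd_def mform_def by blast

lemma mat_psd_herm: "mat_psd I A \<Longrightarrow> a \<in> I \<Longrightarrow> b \<in> I \<Longrightarrow> cnj (A a b) = A b a"
  unfolding mat_psd_def by metis

lemma mform_cnj:
  assumes "mat_psd I A"
  shows "cnj (mform I A p q) = mform I A q p"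
proof -
  have "cnj (mform I A p q) = (\<Sum>a\<in>I. \<Sum>b\<in>I. cnj (q b) * A b a * p a)"
    unfolding mform_def cnj_sum using mat_psd_herm[OF assms]
    by (intro sum.cong) (auto simp: mult_ac)
  also have "\<dots> = mform I A q p"
    unfolding mform_def by (rule sum.swap)
  finally show ?thesis .
qed

lemma mform_add_right: "mform I A p (\<lambda>b. q b + c * r b) = mform I A p q + c * mform I A p r"
  unfolding mform_def sum_distrib_left sum.distrib[symmetric]
  by (intro sum.cong refl) (simp add: distrib_left distrib_right mult_ac)

lemma mform_add_left: "mform I A (\<lambda>b. q b + c * r b) p = mform I A q p + cnj c * mform I A r p"
  unfolding mform_def sum_distrib_left sum.distrib[symmetric]
  by (intro sum.cong refl) (simp add: distrib_left distrib_right mult_ac)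

text \<open>If \<open>u\<close> paired with some \<open>v\<close> to a nonzero number, adding a
  large multiple of \<open>u\<close> to \<open>v\<close> would make the form negative, since the
  term quadratic in that multiple vanishes.\<close>

lemma mat_psd_kernel:
  assumes "finite I" "mat_psd I A" "mform I A u u = 0" "a \<in> I"
  shows "(\<Sum>b\<in>I. A a b * u b) = 0"
proof -
  have zero: "mform I A u v = 0" for v
  proof (rule ccontr)
    define z where "z = mform I A u v"
    define c where "c = (cmod z)\<^sup>2"
    assume "mform I A u v \<noteq> 0"
    then have "c > 0" by (simp add: c_def z_def)
    \<comment> \<open>Chosen so that \<open>2 * r * c\<close> exceeds
      \<open>Re (mform I A v v)\<close> by 1.\<close>
    define r where "r = (Re (mform I A v v) + 1) / (2 * c)"
    have zz: "z * cnj z = of_real c"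
      unfolding c_def by (rule complex_norm_square[symmetric])
    have "mform I A (\<lambda>b. v b + (- r * z) * u b) (\<lambda>b. v b + (- r * z) * u b)
        = mform I A v v - 2 * of_real r * (z * cnj z)"
      unfolding mform_add_right mform_add_left
      using assms(3) mform_cnj[OF assms(2), of u v]
      by (simp add: z_def algebra_simps)
    also have "\<dots> = mform I A v v - of_real (2 * r * c)"
      unfolding zz by simp
    finally have "Re (mform I A v v) - 2 * r * c \<ge> 0"
      using mat_psd_nonneg[OF assms(2)] by (metis Re_complex_of_real minus_complex.sel(1))
    then show False
      using \<open>c > 0\<close> by (simp add: r_def)
  qed
  \<comment> \<open>Pairing with the unit vector at \<open>a\<close> reads off row
    \<open>a\<close>.\<close>
  have "mform I A (\<lambda>b. if b = a then 1 else 0) u = 0"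
    using zero mform_cnj[OF assms(2)] by (metis complex_cnj_zero)
  then show ?thesis
    using assms(1,4) by (simp add: mform_row if_distrib if_distribR cong: if_cong)
qed

text \<open>Nonnegativity of the form at \<open>v\<close> minus its orthogonal projection onto
  \<open>u\<close>.\<close>

lemma mat_psd_cauchy_schwarz:
  assumes "mat_psd I A" "mform I A u u = of_real s" "s > 0"
  shows "(cmod (mform I A u v))\<^sup>2 / s \<le> Re (mform I A v v)"
proof -
  define z where "z = mform I A u v"
  have "mform I A (\<lambda>b. v b + (- z / s) * u b) (\<lambda>b. v b + (- z / s) * u b)
      = mform I A v v - z * cnj z / s"
    unfolding mform_add_right mform_add_left
    using assms(2,3) mform_cnj[OF assms(1), of u v]
    by (simp add: z_def[symmetric] field_simps)
  also have "\<dots> = mform I A v v - of_real ((cmod z)\<^sup>2 / s)"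
    using complex_norm_square[of z] by simp
  finally show ?thesis
    using mat_psd_nonneg[OF assms(1)] z_def
    by (metis Re_complex_of_real diff_ge_0_iff_ge minus_complex.sel(1))
qed

lemma cfun_restrict_span:
  assumes "h \<in> cfun.span D"
  shows "(\<lambda>a. if a \<in> J then h a else 0) \<in> cfun.span ((\<lambda>h a. if a \<in> J then h a else 0) ` D)"
    (is "?r h \<in> _")
  using assms
proof (induction rule: cfun.span_induct_alt)
  case base
  have "?r 0 = 0" by (simp add: fun_eq_iff)
  then show ?case using cfun.span_zero by simp
next
  case (step c x k)
  have "?r ((\<lambda>a. c * x a) + k) = (\<lambda>a. c * ?r x a) + ?r k"
    by (auto simp: fun_eq_iff)
  also have "\<dots> \<in> cfun.span (?r ` D)"
    using step by (intro cfun.span_add cfun.span_scale) (auto intro: cfun.span_base)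
  finally show ?case .
qed

text \<open>Deleting the rows outside \<open>J\<close> is linear and cannot raise the dimension, so
  the columns indexed by \<open>J\<close> span at least the rank of the small block. Equality of the
  ranks leaves no new direction for the other columns.\<close>

lemma flat_columns:
  assumes "finite I" "J \<subseteq> I" "mat_rank I A = mat_rank J A"
  shows "matcol I A ` I \<subseteq> cfun.span (matcol I A ` J)"
proof -
  let ?r = "\<lambda>h a. if a \<in> J then h a else (0::complex)"
  obtain D where D: "D \<subseteq> matcol I A ` J" "cfun.independent D" "matcol I A ` J \<subseteq> cfun.span D"
      "card D = cfun.dim (matcol I A ` J)"
    by (rule cfun.basis_exists)
  have finD: "finite D"
    using D(1) assms(1,2) by (meson finite_imageI finite_subset)
  have "matcol J A ` J \<subseteq> cfun.span (?r ` D)"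
  proof
    fix v assume "v \<in> matcol J A ` J"
    then obtain b where b: "b \<in> J" "v = matcol J A b" by blast
    then have "v = ?r (matcol I A b)"
      using assms(2) by (auto simp: matcol_def fun_eq_iff)
    also have "\<dots> \<in> cfun.span (?r ` D)"
      by (rule cfun_restrict_span) (use D(3) b(1) in blast)
    finally show "v \<in> cfun.span (?r ` D)" .
  qed
  then have "cfun.dim (matcol J A ` J) \<le> card (?r ` D)"
    using finD by (intro cfun.dim_le_card) auto
  also have "\<dots> \<le> card D" by (rule card_image_le[OF finD])
  finally have "cfun.dim (matcol I A ` I) \<le> cfun.dim (matcol I A ` J)"
    using assms(3) D(4) by (simp add: mat_rank_matcol)
  then show ?thesis
    by (rule cfun_span_eq_of_dim_le[OF finite_imageI[OF assms(1)] cfun.span_superset image_mono[OF assms(2)]])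
qed

section \<open>Multi-indices, monomials and coefficient vectors\<close>

lemma finite_midx [simp]: "finite (midx t)"
proof -
  have "midx t \<subseteq> vec_lambda ` (Pi\<^sub>E UNIV (\<lambda>_. {..t}))"
  proof
    fix a :: "nat ^ 'n" assume a: "a \<in> midx t"
    have "a $ i \<le> t" for i
    proof -
      have "a $ i \<le> mdeg a"
        unfolding mdeg_def by (rule member_le_sum) auto
      then show ?thesis using a by (simp add: midx_def)
    qed
    then have "vec_nth a \<in> Pi\<^sub>E UNIV (\<lambda>_. {..t})" by (simp add: PiE_def Pi_def)
    then have "vec_lambda (vec_nth a) \<in> vec_lambda ` (Pi\<^sub>E UNIV (\<lambda>_. {..t}))"
      by (rule imageI)
    then show "a \<in> vec_lambda ` (Pi\<^sub>E UNIV (\<lambda>_. {..t}))" by simp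
  qed
  then show ?thesis
    by (rule finite_subset[OF _ finite_imageI[OF finite_PiE[OF finite_class.finite_UNIV finite_atMost]]])
qed

lemma mdeg_add: "mdeg (a + b) = mdeg a + mdeg b"
  by (simp add: mdeg_def sum.distrib)

lemma mdeg_axis [simp]: "mdeg (axis i 1) = 1"
  by (simp add: mdeg_def axis_def)

lemma midx_mono: "s \<le> t \<Longrightarrow> midx s \<subseteq> midx t"
  by (auto simp: midx_def)

lemma mpow_add: "mpow z (a + b) = mpow z a * mpow z b"
  by (simp add: mpow_def power_add prod.distrib)

lemma mpow_axis [simp]: "mpow z (axis i 1) = z $ i"
proof -
  have "mpow z (axis i 1) = (\<Prod>j\<in>UNIV. if j = i then z $ i else 1)"
    unfolding mpow_def by (rule prod.cong) (auto simp: axis_def)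
  then show ?thesis by simp
qed

lemma mpow_0 [simp]: "mpow z 0 = 1"
  by (simp add: mpow_def)

lemma mdeg_eq_0_iff: "mdeg a = 0 \<longleftrightarrow> a = 0"
  by (simp add: mdeg_def vec_eq_iff)

lemma mdeg_Suc_split:
  assumes "mdeg a = Suc n"
  obtains b i where "a = b + axis i 1" "mdeg b = n"
proof -
  obtain i where i: "a $ i > 0"
    using assms by (metis mdeg_eq_0_iff gr0I nat.simps(3) vec_eq_iff zero_index)
  define b where "b = (\<chi> j. a $ j - axis i 1 $ j)"
  have "a = b + axis i 1"
    using i by (simp add: b_def vec_eq_iff axis_def)
  moreover from this have "mdeg b = n"
    using assms by (simp add: mdeg_add del: One_nat_def)
  ultimately show ?thesis by (rule that)
qed

lemma mpow_real:
  assumes "\<And>i. x $ i \<in> \<real>"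
  shows "cnj (mpow x a) = mpow x a"
proof -
  have "mpow x a \<in> \<real>"
    unfolding mpow_def by (intro prod_in_Reals Reals_power assms)
  then show ?thesis by (simp add: Reals_cnj_iff)
qed

text \<open>The coefficients are padded by zero from \<open>J\<close> to \<open>I\<close>, so that a
  combination of some columns becomes the full matrix times a vector, the shape that
  \<open>mform\<close> works with.\<close>

lemma matcol_span_coeffs:
  assumes "h \<in> cfun.span (matcol I A ` J)" "finite I" "J \<subseteq> I"
  obtains p where "\<And>b. b \<notin> J \<Longrightarrow> p b = 0" "\<And>a. a \<in> I \<Longrightarrow> h a = (\<Sum>b\<in>I. A a b * p b)"
    "\<And>a. a \<notin> I \<Longrightarrow> h a = 0"
proof -
  obtain p where p: "h = (\<lambda>a. \<Sum>b\<in>J. p b * matcol I A b a)"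
    using cfun_image_span[OF assms(1)] assms(2,3) finite_subset by blast
  show ?thesis
  proof (rule that[of "\<lambda>b. if b \<in> J then p b else 0"])
    fix a assume "a \<in> I"
    then have "h a = (\<Sum>b\<in>J. A a b * p b)"
      by (simp add: p matcol_def mult.commute)
    also have "\<dots> = (\<Sum>b\<in>I. A a b * (if b \<in> J then p b else 0))"
      using assms(2,3) by (intro sum.mono_neutral_cong_left) auto
    finally show "h a = (\<Sum>b\<in>I. A a b * (if b \<in> J then p b else 0))" .
  qed (simp_all add: p matcol_def)
qed

section \<open>Extraction of atoms\<close>

lemma hankelD:
  "hankel d y \<Longrightarrow> a \<in> midx d \<Longrightarrow> b \<in> midx d \<Longrightarrow> c \<in> midx d \<Longrightarrow> e \<in> midx d \<Longrightarrow>
    a + b = c + e \<Longrightarrow> y a b = y c e"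
  unfolding hankel_def by blast

text \<open>Each unit step in the index multiplies by a coordinate of \<open>x\<close>, so the value
  at 0 determines all others by induction on the degree.\<close>

lemma mpow_eq_of_shift:
  assumes "\<And>a i. mdeg a < d \<Longrightarrow> h (a + axis i 1) = x $ i * h a" "mdeg a \<le> d"
  shows "h a = h 0 * mpow x a"
  using assms(2)
proof (induction "mdeg a" arbitrary: a)
  case 0
  then show ?case using mdeg_eq_0_iff[of a] by simp
next
  case (Suc n)
  obtain b i where b: "a = b + axis i 1" "mdeg b = n"
    using mdeg_Suc_split[OF Suc.hyps(2)[symmetric]] .
  have "h b = h 0 * mpow x b"
    by (rule Suc.hyps(1)) (use b Suc in auto)
  moreover have "h a = x $ i * h b"
    unfolding b(1) by (rule assms(1)) (use b Suc in auto)
  ultimately show ?case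
    unfolding b(1) mpow_add mpow_axis by simp
qed

text \<open>Supplies the next atom: a common eigenvector of the shifts is, after scaling, the
  evaluation vector at \<open>x\<close>, and \<open>u\<close> is a preimage of it under the moment
  matrix, of degree at most \<open>t\<close>. The inverse of \<open>s\<close> will be the weight.
  The gap \<open>t < d\<close> leaves room for a shift by one.\<close>

lemma hankel_flat_evaluation:
  fixes y :: "'n::finite multi \<Rightarrow> 'n multi \<Rightarrow> complex"
  assumes psd: "mat_psd (midx d) y" and hankel: "hankel d y" and td: "t < d"
    and flat: "matcol (midx d) y ` midx d \<subseteq> cfun.span (matcol (midx d) y ` midx t)"
    and nz: "a0 \<in> midx d" "b0 \<in> midx d" "y a0 b0 \<noteq> 0"
  obtains s x u where "s > 0" "\<And>i. x $ i \<in> \<real>" "\<And>b. b \<notin> midx t \<Longrightarrow> u b = 0"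
    "\<And>a. a \<in> midx d \<Longrightarrow> (\<Sum>b\<in>midx d. y a b * u b) = mpow x a"
    "mform (midx d) y u u = of_real s"
proof -
  let ?I = "midx d :: 'n multi set" and ?J = "midx t :: 'n multi set"
  define col where "col = matcol ?I y"
  define C where "C = cfun.span (col ` ?J)"
  have JI: "?J \<subseteq> ?I" using td by (intro midx_mono) simp
  have up: "a + axis i 1 \<in> ?I" if "mdeg a < d" for a i
    using that by (simp add: midx_def mdeg_add del: One_nat_def)
  have Jup: "a + axis i 1 \<in> ?I" "mdeg a < d" "a \<in> ?I" if "a \<in> ?J" for a i
    using that td up[of a i] by (auto simp: midx_def)
  have colC: "col b \<in> C" if "b \<in> ?I" for b
    using flat that unfolding C_def col_def by blast
  have col_I: "col b a = y a b" if "a \<in> ?I" for a b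
    using that by (simp add: col_def matcol_def)
  have subC: "cfun.subspace C" unfolding C_def by (rule cfun.subspace_span)
  have coeffs: "\<exists>p. (\<forall>b. b \<notin> ?J \<longrightarrow> p b = 0) \<and> (\<forall>a\<in>?I. h a = (\<Sum>b\<in>?I. y a b * p b)) \<and>
      (\<forall>a. a \<notin> ?I \<longrightarrow> h a = 0)" if "h \<in> C" for h
    using matcol_span_coeffs[OF that[unfolded C_def col_def] finite_midx JI] by metis
  \<comment> \<open>Write \<open>h\<close> as the matrix times some \<open>p\<close> supported in
    \<open>?J\<close>. The form at \<open>p\<close> sees only the entries of \<open>h\<close> in
    \<open>?J\<close>, so \<open>p\<close> is isotropic and lies in the kernel.\<close>
  have zero: "h = 0" if h: "h \<in> C" "\<And>a. a \<in> ?J \<Longrightarrow> h a = 0" for h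
  proof -
    obtain p where p: "\<And>b. b \<notin> ?J \<Longrightarrow> p b = 0" "\<And>a. a \<in> ?I \<Longrightarrow> h a = (\<Sum>b\<in>?I. y a b * p b)"
      "\<And>a. a \<notin> ?I \<Longrightarrow> h a = 0"
      using coeffs[OF h(1)] by blast
    have "mform ?I y p p = (\<Sum>a\<in>?I. cnj (p a) * h a)"
      unfolding mform_row using p(2) by simp
    also have "\<dots> = 0"
      using p(1) h(2) by (intro sum.neutral) (metis complex_cnj_zero mult_zero_left mult_zero_right)
    finally have "mform ?I y p p = 0" .
    then have "h a = 0" for a
      using mat_psd_kernel[OF finite_midx psd] p(2,3) by (cases "a \<in> ?I") auto
    then show ?thesis by (simp add: fun_eq_iff)
  qed
  have uniq: "h = k" if "h \<in> C" "k \<in> C" "\<And>a. a \<in> ?J \<Longrightarrow> h a = k a" for h k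
    using zero[of "h - k"] cfun.subspace_diff[OF subC that(1,2)] that(3) by simp
  have "\<forall>h\<in>C. \<exists>p. h = (\<lambda>a. \<Sum>b\<in>?J. p b * col b a)"
    using cfun_image_span finite_midx unfolding C_def by blast
  then obtain pf where pf: "\<And>h. h \<in> C \<Longrightarrow> h = (\<lambda>a. \<Sum>b\<in>?J. pf h b * col b a)"
    by metis
  \<comment> \<open>The shift acts on the column indices of a chosen combination. By
    \<open>T_J\<close> its entries in \<open>?J\<close> depend on \<open>h\<close> alone, so by
    \<open>uniq\<close> the choice does not matter.\<close>
  define T where "T i h = (\<lambda>a. \<Sum>b\<in>?J. pf h b * col (b + axis i 1) a)" for i h
  have T_in: "T i h \<in> C" for i h
    unfolding T_def C_def by (rule cfun_sum_in_span) (use colC Jup C_def in blast)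
  \<comment> \<open>The Hankel property moves the unit step from the column to the row index. Rows
    up to degree \<open>d - 1\<close>, not just those in \<open>?J\<close>, are covered, so that the
    eigenvector relation later reaches all of \<open>?I\<close>.\<close>
  have T_shift: "T i h a = h (a + axis i 1)" if h: "h \<in> C" and a: "mdeg a < d" for i h a
  proof -
    have aI: "a \<in> ?I" using a by (simp add: midx_def)
    have "T i h a = (\<Sum>b\<in>?J. pf h b * y a (b + axis i 1))"
      by (simp add: T_def col_I aI)
    also have "\<dots> = (\<Sum>b\<in>?J. pf h b * y (a + axis i 1) b)"
    proof (rule sum.cong)
      fix b assume "b \<in> ?J"
      then show "pf h b * y a (b + axis i 1) = pf h b * y (a + axis i 1) b"
        using hankelD[OF hankel aI Jup(1)[of b i] up[OF a] Jup(3)[of b]] by (simp add: ac_simps)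
    qed simp
    also have "\<dots> = h (a + axis i 1)"
      by (subst (2) pf[OF h]) (simp add: col_I up[OF a] del: One_nat_def)
    finally show ?thesis .
  qed
  have T_J: "T i h a = h (a + axis i 1)" if "h \<in> C" "a \<in> ?J" for i h a
    using that Jup(2) T_shift by blast
  have T_add: "T i (h + k) = T i h + T i k" if h: "h \<in> C" and k: "k \<in> C" for i h k
  proof (rule uniq)
    show "T i h + T i k \<in> C" using cfun.subspace_add[OF subC T_in T_in] .
    fix a assume a: "a \<in> ?J"
    show "T i (h + k) a = (T i h + T i k) a"
      unfolding plus_fun_apply T_J[OF h a] T_J[OF k a] T_J[OF cfun.subspace_add[OF subC h k] a] ..
  qed (rule T_in)
  have T_scale: "T i (\<lambda>x. c * h x) = (\<lambda>x. c * T i h x)" if h: "h \<in> C" for i c h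
  proof (rule uniq)
    show "(\<lambda>x. c * T i h x) \<in> C" using cfun.subspace_scale[OF subC T_in] .
    fix a assume a: "a \<in> ?J"
    show "T i (\<lambda>x. c * h x) a = c * T i h a"
      unfolding T_J[OF h a] T_J[OF cfun.subspace_scale[OF subC h] a] ..
  qed (rule T_in)
  \<comment> \<open>On \<open>?J\<close> both sides are sums of entries whose indices add up to
    \<open>a + b + axis i 1 + axis j 1\<close>; the Hankel property identifies them.\<close>
  have T_comm: "T i (T j h) = T j (T i h)" for i j h
  proof (rule uniq)
    fix a assume a: "a \<in> ?J"
    have "(\<Sum>b\<in>?J. pf h b * col (b + axis j 1) (a + axis i 1))
        = (\<Sum>b\<in>?J. pf h b * col (b + axis i 1) (a + axis j 1))"
    proof (rule sum.cong)
      fix b assume b: "b \<in> ?J"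
      show "pf h b * col (b + axis j 1) (a + axis i 1) = pf h b * col (b + axis i 1) (a + axis j 1)"
        unfolding col_I[OF Jup(1)[OF a]]
        using hankelD[OF hankel Jup(1)[OF a, of i] Jup(1)[OF b, of j] Jup(1)[OF a, of j] Jup(1)[OF b, of i]]
        by (simp add: ac_simps)
    qed simp
    then show "T i (T j h) a = T j (T i h) a"
      unfolding T_J[OF T_in a] by (simp only: T_def)
  qed (rule T_in)+
  have "col b0 \<in> C" "col b0 \<noteq> 0"
    using colC[OF nz(2)] col_I[OF nz(1), of b0] nz(3) by (metis zero_fun_apply)+
  then have "\<exists>h\<in>C. h \<noteq> 0 \<and> (\<forall>i. \<exists>a. T i h = (\<lambda>x. a * h x))"
    by (intro cfun_common_eigenvector[where B = "col ` ?J" and T = T] subC T_in T_add T_scale T_comm)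
      (simp_all add: C_def)
  then obtain k x' where k: "k \<in> C" "k \<noteq> 0" and ev': "\<And>i. T i k = (\<lambda>a. x' i * k a)"
    by metis
  define x where "x = (\<chi> i. x' i)"
  have "k (a + axis i 1) = x $ i * k a" if "mdeg a < d" for a i
    using T_shift[OF k(1) that, of i] ev'[of i] by (simp add: x_def)
  then have k_mpow: "k a = k 0 * mpow x a" if "a \<in> ?I" for a
    using that by (intro mpow_eq_of_shift[where d = d]) (simp_all add: midx_def)
  \<comment> \<open>An eigenvector vanishing at 0 would vanish on \<open>?J\<close>, hence
    everywhere.\<close>
  have k0: "k 0 \<noteq> 0"
  proof
    assume "k 0 = 0"
    then have "k a = 0" if "a \<in> ?J" for a
      using k_mpow[of a] JI that by auto
    with zero[OF k(1)] k(2) show False by blast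
  qed
  define h where "h = (\<lambda>a. inverse (k 0) * k a)"
  have hC: "h \<in> C" unfolding h_def by (rule cfun.subspace_scale[OF subC k(1)])
  have h_mpow: "h a = mpow x a" if "a \<in> ?I" for a
    using k_mpow[OF that] k0 by (simp add: h_def)
  obtain u where u: "\<And>b. b \<notin> ?J \<Longrightarrow> u b = 0" "\<And>a. a \<in> ?I \<Longrightarrow> h a = (\<Sum>b\<in>?I. y a b * u b)"
    using coeffs[OF hC] by blast
  define s where "s = Re (mform ?I y u u)"
  have form: "mform ?I y u u = of_real s"
  proof -
    have "Im (mform ?I y u u) = 0"
      using mform_cnj[OF psd, of u u] by (metis Reals_cnj_iff complex_is_Real_iff)
    then show ?thesis by (simp add: s_def complex_eq_iff)
  qed
  have Mu: "(\<Sum>b\<in>?I. y a b * u b) = mpow x a" if "a \<in> ?I" for a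
    using u(2)[OF that] h_mpow[OF that] by simp
  \<comment> \<open>For \<open>s = 0\<close> the vector \<open>u\<close> would lie in the kernel,
    but the entry at 0 of its image is \<open>mpow x 0 = 1\<close>.\<close>
  have "s \<noteq> 0"
  proof
    assume "s = 0"
    then have "(\<Sum>b\<in>?I. y 0 b * u b) = 0"
      using form by (intro mat_psd_kernel[OF finite_midx psd]) (auto simp: midx_def mdeg_def)
    then show False
      using Mu[of 0] by (simp add: midx_def mdeg_def)
  qed
  moreover have "s \<ge> 0" using mat_psd_nonneg[OF psd] by (simp add: s_def)
  ultimately have s: "s > 0" by simp
  \<comment> \<open>Self-adjointness of the shift: \<open>R\<close> is the form at \<open>u\<close>
    with one shift inserted. Hermitian symmetry and the Hankel property make it real, and it equals
    \<open>x $ i\<close> times \<open>s\<close>.\<close>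
  have x_real: "x $ i \<in> \<real>" for i
  proof -
    define R where "R = (\<Sum>a\<in>?J. \<Sum>b\<in>?J. cnj (u a) * y (a + axis i 1) b * u b)"
    have restrict: "(\<Sum>b\<in>?I. f b * u b) = (\<Sum>b\<in>?J. f b * u b)" for f
      using JI u(1) by (intro sum.mono_neutral_right) auto
    have cnj_y: "cnj (y (a + axis i 1) b) = y (b + axis i 1) a" if "a \<in> ?J" "b \<in> ?J" for a b
    proof -
      have "cnj (y (a + axis i 1) b) = y b (a + axis i 1)"
        by (rule mat_psd_herm[OF psd Jup(1)[OF that(1)] Jup(3)[OF that(2)]])
      also have "\<dots> = y (b + axis i 1) a"
        using that by (intro hankelD[OF hankel] Jup) (simp_all add: ac_simps)
      finally show ?thesis .
    qed
    have "cnj R = (\<Sum>a\<in>?J. \<Sum>b\<in>?J. cnj (u b) * y (b + axis i 1) a * u a)"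
      unfolding R_def cnj_sum by (intro sum.cong refl) (simp add: cnj_y mult_ac del: One_nat_def)
    also have "\<dots> = R"
      unfolding R_def by (rule sum.swap)
    finally have "R \<in> \<real>" by (simp add: Reals_cnj_iff)
    have "R = (\<Sum>a\<in>?J. cnj (u a) * mpow x (a + axis i 1))"
      unfolding R_def
    proof (intro sum.cong refl)
      fix a assume a: "a \<in> ?J"
      show "(\<Sum>b\<in>?J. cnj (u a) * y (a + axis i 1) b * u b) = cnj (u a) * mpow x (a + axis i 1)"
        unfolding Mu[OF Jup(1)[OF a], symmetric] restrict by (simp add: sum_distrib_left mult.assoc)
    qed
    also have "\<dots> = x $ i * (\<Sum>a\<in>?J. cnj (u a) * mpow x a)"
      unfolding mpow_add mpow_axis by (simp add: sum_distrib_left mult_ac)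
    also have "(\<Sum>a\<in>?J. cnj (u a) * mpow x a) = (\<Sum>a\<in>?I. cnj (u a) * mpow x a)"
      using JI u(1) by (intro sum.mono_neutral_left) auto
    also have "\<dots> = of_real s"
      unfolding form[symmetric] mform_row using Mu by (intro sum.cong) auto
    finally have "x $ i = R / of_real s" using s by (simp add: field_simps)
    then show ?thesis using \<open>R \<in> \<real>\<close> by (simp add: Reals_divide)
  qed
  show ?thesis by (rule that[OF s x_real u(1) Mu form])
qed

section \<open>Polynomial evaluation and atomic moment matrices\<close>

definition peval :: "'n::finite multi set \<Rightarrow> ('n multi \<Rightarrow> complex) \<Rightarrow> complex ^ 'n \<Rightarrow> complex" where
  "peval I p z = (\<Sum>b\<in>I. p b * mpow z b)"

lemma peval_axpy: "peval I (\<lambda>b. p b + c * q b) z = peval I p z + c * peval I q z"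
  by (simp add: peval_def distrib_right sum.distrib sum_distrib_left mult.assoc)

lemma atomic_row:
  assumes "\<And>a b. a \<in> I \<Longrightarrow> b \<in> I \<Longrightarrow> A a b = (\<Sum>x\<in>X. c x * cnj (mpow x a) * mpow x b)" "a \<in> I"
  shows "(\<Sum>b\<in>I. A a b * q b) = (\<Sum>x\<in>X. c x * peval I q x * cnj (mpow x a))"
proof -
  have "(\<Sum>b\<in>I. A a b * q b) = (\<Sum>b\<in>I. \<Sum>x\<in>X. c x * cnj (mpow x a) * mpow x b * q b)"
    using assms by (intro sum.cong) (simp_all add: sum_distrib_right)
  also have "\<dots> = (\<Sum>x\<in>X. \<Sum>b\<in>I. c x * cnj (mpow x a) * mpow x b * q b)"
    by (rule sum.swap)
  also have "\<dots> = (\<Sum>x\<in>X. c x * peval I q x * cnj (mpow x a))"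
    by (intro sum.cong refl) (simp add: peval_def sum_distrib_left sum_distrib_right mult_ac)
  finally show ?thesis .
qed

text \<open>In terms of point values an atomic matrix is diagonal. The weights are complex so that
  the identity also serves localizing matrices, whose weights contain values of the localizing
  polynomial.\<close>

lemma atomic_form:
  assumes "\<And>a b. a \<in> I \<Longrightarrow> b \<in> I \<Longrightarrow> A a b = (\<Sum>x\<in>X. c x * cnj (mpow x a) * mpow x b)"
  shows "mform I A p q = (\<Sum>x\<in>X. c x * cnj (peval I p x) * peval I q x)"
proof -
  have "mform I A p q = (\<Sum>a\<in>I. cnj (p a) * (\<Sum>x\<in>X. c x * peval I q x * cnj (mpow x a)))"
    unfolding mform_row using atomic_row[OF assms] by (intro sum.cong) simp_all
  also have "\<dots> = (\<Sum>a\<in>I. \<Sum>x\<in>X. cnj (p a) * (c x * peval I q x * cnj (mpow x a)))"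
    by (simp add: sum_distrib_left)
  also have "\<dots> = (\<Sum>x\<in>X. \<Sum>a\<in>I. cnj (p a) * (c x * peval I q x * cnj (mpow x a)))"
    by (rule sum.swap)
  also have "\<dots> = (\<Sum>x\<in>X. c x * cnj (peval I p x) * peval I q x)"
    by (intro sum.cong refl)
      (simp add: peval_def[of I p] cnj_sum sum_distrib_left sum_distrib_right mult_ac)
  finally show ?thesis .
qed

text \<open>
  Subtracting the atom at \<open>x\<close> with weight \<open>1 / s\<close> is the extreme case of positivity: it enlarges
  the kernel by \<open>u\<close>, a polynomial that does not vanish at \<open>x\<close> but at all the remaining atoms.
\<close>

lemma hankel_flat_decomposition:
  fixes y :: "'n::finite multi \<Rightarrow> 'n multi \<Rightarrow> complex"
  assumes "t < d" "mat_psd (midx d) y" "hankel d y"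
    "matcol (midx d) y ` midx d \<subseteq> cfun.span (matcol (midx d) y ` midx t)"
  shows "\<exists>X w. finite X \<and> (\<forall>x\<in>X. w x > (0::real)) \<and>
    (\<forall>a\<in>midx d. \<forall>b\<in>midx d. y a b = (\<Sum>x\<in>X. of_real (w x) * cnj (mpow x a) * mpow x b)) \<and>
    (\<forall>x\<in>X. \<exists>q. \<forall>z\<in>X. peval (midx t) q z = (if z = x then 1 else 0))"
  using assms(2-)
proof (induction "mat_rank (midx d) y" arbitrary: y rule: less_induct)
  case less
  note psd = less.prems(1) and hankel = less.prems(2) and flat = less.prems(3)
  let ?I = "midx d :: 'n multi set" and ?J = "midx t :: 'n multi set"
  have JI: "?J \<subseteq> ?I" using assms(1) by (intro midx_mono) simp
  show ?case
  proof (cases "\<forall>a\<in>?I. \<forall>b\<in>?I. y a b = 0")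
    case True
    then show ?thesis by (intro exI[of _ "{}"]) simp
  next
    case False
    then obtain a0 b0 where nz: "a0 \<in> ?I" "b0 \<in> ?I" "y a0 b0 \<noteq> 0" by blast
    obtain s x u where s: "s > 0" and x: "\<And>i. x $ i \<in> \<real>" and u: "\<And>b. b \<notin> ?J \<Longrightarrow> u b = 0"
      and Mu: "\<And>a. a \<in> ?I \<Longrightarrow> (\<Sum>b\<in>?I. y a b * u b) = mpow x a"
      and form: "mform ?I y u u = of_real s"
      by (rule hankel_flat_evaluation[OF psd hankel assms(1) flat nz]) blast
    have real_x: "cnj (mpow x a) = mpow x a" for a using mpow_real x by blast
    have sym: "y a b = y b a" if "a \<in> ?I" "b \<in> ?I" for a b
      using hankelD[OF hankel that that(2,1)] by (simp add: add.commute)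
    \<comment> \<open>No conjugate appears because \<open>x\<close> is real; the subtracted entry
      depends on \<open>a + b\<close> only, and so \<open>y'\<close> stays Hankel.\<close>
    define y' where "y' a b = y a b - inverse (of_real s) * mpow x a * mpow x b" for a b
    \<comment> \<open>The image of \<open>u\<close> is the evaluation vector, so pairing with
      \<open>u\<close> evaluates at \<open>x\<close>.\<close>
    have form_u: "mform ?I y u v = peval ?I v x" for v
    proof -
      have "mform ?I y u v = cnj (mform ?I y v u)" using mform_cnj[OF psd] by metis
      also have "\<dots> = peval ?I v x"
        unfolding mform_row peval_def cnj_sum by (intro sum.cong refl) (simp add: Mu real_x)
      finally show ?thesis .
    qed
    have ux: "peval ?I u x = of_real s" using form_u[of u] form by simp
    have form': "mform ?I y' v v = mform ?I y v v - of_real ((cmod (peval ?I v x))\<^sup>2 / s)" for v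
    proof -
      have "mform ?I y' v v = mform ?I y v v - inverse (of_real s) *
          (\<Sum>a\<in>?I. \<Sum>b\<in>?I. cnj (v a * mpow x a) * (v b * mpow x b))"
        unfolding mform_def y'_def sum_distrib_left sum_subtractf[symmetric]
        by (intro sum.cong refl) (simp add: real_x algebra_simps)
      also have "(\<Sum>a\<in>?I. \<Sum>b\<in>?I. cnj (v a * mpow x a) * (v b * mpow x b))
          = peval ?I v x * cnj (peval ?I v x)"
        unfolding peval_def cnj_sum sum_product[symmetric] by (rule mult.commute)
      also have "\<dots> = of_real ((cmod (peval ?I v x))\<^sup>2)"
        by (rule complex_norm_square[symmetric])
      finally show ?thesis by (simp add: divide_inverse mult.commute)
    qed
    have Mu': "(\<Sum>b\<in>?I. y' a b * u b) = 0" if "a \<in> ?I" for a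
    proof -
      have "(\<Sum>b\<in>?I. y' a b * u b) = (\<Sum>b\<in>?I. y a b * u b) - inverse (of_real s) * mpow x a * peval ?I u x"
        unfolding y'_def peval_def sum_distrib_left sum_subtractf[symmetric]
        by (intro sum.cong refl) (simp add: algebra_simps)
      then show ?thesis using s by (simp add: Mu[OF that] ux)
    qed
    \<comment> \<open>The subtracted term is the squared modulus of the value of \<open>v\<close> at
      \<open>x\<close>, divided by \<open>s\<close>; Cauchy-Schwarz against \<open>u\<close> bounds
      it by the form of \<open>y\<close> at \<open>v\<close>.\<close>
    have psd': "mat_psd ?I y'"
      unfolding mat_psd_def mform_def[symmetric]
    proof (intro conjI ballI allI)
      fix a b assume "a \<in> ?I" "b \<in> ?I"
      then show "y' b a = cnj (y' a b)"
        by (simp add: y'_def real_x mat_psd_herm[OF psd] mult_ac)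
    next
      fix v
      show "Re (mform ?I y' v v) \<ge> 0"
        using mat_psd_cauchy_schwarz[OF psd form s, of v]
        unfolding form' form_u minus_complex.sel Re_complex_of_real by simp
    qed
    have hankel': "hankel d y'"
      unfolding hankel_def
    proof (intro ballI impI)
      fix a b c e assume *: "a \<in> ?I" "b \<in> ?I" "c \<in> ?I" "e \<in> ?I" "a + b = c + e"
      then have "mpow x a * mpow x b = mpow x c * mpow x e"
        unfolding mpow_add[symmetric] by simp
      then show "y' a b = y' c e"
        using hankelD[OF hankel *] by (simp add: y'_def mult.assoc)
    qed
    \<comment> \<open>A relation expressing column \<open>b\<close> through the columns in
      \<open>?J\<close> also holds between the entries of the evaluation vector, which is a
      combination of the columns of a symmetric matrix. It therefore survives the
      subtraction.\<close>
    have flat': "matcol ?I y' ` ?I \<subseteq> cfun.span (matcol ?I y' ` ?J)"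
    proof (rule image_subsetI)
      fix b assume b: "b \<in> ?I"
      then have "matcol ?I y b \<in> cfun.span (matcol ?I y ` ?J)" using flat by blast
      then obtain p where p: "\<And>c. c \<notin> ?J \<Longrightarrow> p c = 0"
        "\<And>a. a \<in> ?I \<Longrightarrow> matcol ?I y b a = (\<Sum>c\<in>?I. y a c * p c)"
        by (rule matcol_span_coeffs[OF _ finite_midx JI]) blast
      have yp: "y a b = (\<Sum>c\<in>?I. y a c * p c)" if "a \<in> ?I" for a
        using p(2)[OF that] that by (simp add: matcol_def)
      have "mpow x b = (\<Sum>e\<in>?I. \<Sum>c\<in>?I. y c e * p c * u e)"
        unfolding Mu[OF b, symmetric]
      proof (intro sum.cong refl)
        fix e assume e: "e \<in> ?I"
        have "y b e * u e = (\<Sum>c\<in>?I. y e c * p c) * u e"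
          using sym[OF b e] yp[OF e] by simp
        also have "\<dots> = (\<Sum>c\<in>?I. y c e * p c * u e)"
          unfolding sum_distrib_right using sym[OF e] by (intro sum.cong) simp_all
        finally show "y b e * u e = (\<Sum>c\<in>?I. y c e * p c * u e)" .
      qed
      also have "\<dots> = (\<Sum>c\<in>?I. \<Sum>e\<in>?I. y c e * p c * u e)"
        by (rule sum.swap)
      also have "\<dots> = (\<Sum>c\<in>?I. p c * mpow x c)"
        by (intro sum.cong refl) (simp add: Mu[symmetric] sum_distrib_left mult_ac)
      finally have xp: "mpow x b = (\<Sum>c\<in>?I. p c * mpow x c)" .
      have "matcol ?I y' b a = (\<Sum>c\<in>?J. p c * matcol ?I y' c a)" for a
      proof (cases "a \<in> ?I")
        case True
        have "y' a b = (\<Sum>c\<in>?I. p c * y' a c)"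
          unfolding y'_def yp[OF True] xp
          by (simp add: right_diff_distrib sum_subtractf sum_distrib_left mult_ac)
        also have "\<dots> = (\<Sum>c\<in>?J. p c * y' a c)"
          using JI p(1) by (intro sum.mono_neutral_right) auto
        finally show ?thesis using True by (simp add: matcol_def)
      qed (simp add: matcol_def)
      then have "matcol ?I y' b = (\<lambda>a. \<Sum>c\<in>?J. p c * matcol ?I y' c a)" by blast
      also have "\<dots> \<in> cfun.span (matcol ?I y' ` ?J)"
        by (rule cfun_sum_in_span) (simp add: cfun.span_base)
      finally show "matcol ?I y' b \<in> cfun.span (matcol ?I y' ` ?J)" .
    qed
    \<comment> \<open>The columns of \<open>y'\<close> lie in the column space of \<open>y\<close>.
      If the rank did not drop, the evaluation vector \<open>V\<close> would be the image of some
      \<open>p\<close> under \<open>y'\<close>; since \<open>y'\<close> is symmetric and kills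
      \<open>u\<close>, the value of \<open>u\<close> at \<open>x\<close> would be 0 instead of
      \<open>s\<close>.\<close>
    have rank': "mat_rank ?I y' < mat_rank ?I y"
    proof (rule ccontr)
      assume "\<not> mat_rank ?I y' < mat_rank ?I y"
      then have dim: "cfun.dim (cfun.span (matcol ?I y ` ?I)) \<le> cfun.dim (matcol ?I y' ` ?I)"
        by (simp add: mat_rank_matcol)
      define V where "V = (\<lambda>a. \<Sum>b\<in>?I. u b * matcol ?I y b a)"
      have V_in: "V \<in> cfun.span (matcol ?I y ` ?I)"
        unfolding V_def by (rule cfun_sum_in_span) (simp add: cfun.span_base)
      have V: "V a = (if a \<in> ?I then mpow x a else 0)" for a
        using Mu[of a] by (simp add: V_def matcol_def mult.commute)
      have sub: "matcol ?I y' ` ?I \<subseteq> cfun.span (matcol ?I y ` ?I)"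
      proof (rule image_subsetI)
        fix b assume b: "b \<in> ?I"
        have "matcol ?I y' b = matcol ?I y b - (\<lambda>a. (inverse (of_real s) * mpow x b) * V a)"
        proof (rule ext)
          fix a
          have "y' a b = y a b - (inverse (of_real s) * mpow x b) * mpow x a"
            unfolding y'_def by (simp only: mult.assoc mult.commute[of "mpow x a"])
          then show "matcol ?I y' b a
              = (matcol ?I y b - (\<lambda>a. (inverse (of_real s) * mpow x b) * V a)) a"
            by (simp add: matcol_def V)
        qed
        also have "\<dots> \<in> cfun.span (matcol ?I y ` ?I)"
          using b by (intro cfun.span_diff cfun.span_scale V_in) (simp add: cfun.span_base)
        finally show "matcol ?I y' b \<in> cfun.span (matcol ?I y ` ?I)" .
      qed
      have "V \<in> cfun.span (matcol ?I y' ` ?I)"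
        using cfun_span_eq_of_dim_le[OF finite_imageI[OF finite_midx] order_refl sub dim] V_in by blast
      then obtain p where p: "\<And>a. a \<in> ?I \<Longrightarrow> V a = (\<Sum>b\<in>?I. y' a b * p b)"
        by (rule matcol_span_coeffs[OF _ finite_midx order_refl]) blast
      have "peval ?I u x = (\<Sum>a\<in>?I. \<Sum>b\<in>?I. y' a b * p b * u a)"
        unfolding peval_def
      proof (intro sum.cong refl)
        fix a assume a: "a \<in> ?I"
        have "mpow x a = (\<Sum>b\<in>?I. y' a b * p b)" using p[OF a] V[of a] a by simp
        then show "u a * mpow x a = (\<Sum>b\<in>?I. y' a b * p b * u a)"
          by (subst mult.commute) (simp add: sum_distrib_right)
      qed
      also have "\<dots> = (\<Sum>b\<in>?I. \<Sum>a\<in>?I. y' a b * p b * u a)"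
        by (rule sum.swap)
      also have "\<dots> = (\<Sum>b\<in>?I. p b * (\<Sum>a\<in>?I. y' b a * u a))"
      proof (intro sum.cong refl)
        fix b assume b: "b \<in> ?I"
        have "y' a b = y' b a" if "a \<in> ?I" for a
          unfolding y'_def sym[OF that b] by (simp only: mult.assoc mult.commute[of "mpow x a"])
        then have "(\<Sum>a\<in>?I. y' a b * p b * u a) = (\<Sum>a\<in>?I. p b * (y' b a * u a))"
          by (intro sum.cong) simp_all
        then show "(\<Sum>a\<in>?I. y' a b * p b * u a) = p b * (\<Sum>a\<in>?I. y' b a * u a)"
          by (simp add: sum_distrib_left)
      qed
      also have "\<dots> = 0" using Mu' by simp
      finally show False using ux s by simp
    qed
    obtain X w where X: "finite X" and w: "\<And>z. z \<in> X \<Longrightarrow> w z > 0"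
      and y': "\<And>a b. a \<in> ?I \<Longrightarrow> b \<in> ?I \<Longrightarrow> y' a b = (\<Sum>z\<in>X. of_real (w z) * cnj (mpow z a) * mpow z b)"
      and dual: "\<And>z. z \<in> X \<Longrightarrow> \<exists>q. \<forall>z'\<in>X. peval ?J q z' = (if z' = z then 1 else 0)"
      using less.hyps[OF rank' psd' hankel' flat']
    proof (elim exE conjE)
      fix X w
      assume *: "finite X" "\<forall>z\<in>X. w z > 0"
        "\<forall>a\<in>?I. \<forall>b\<in>?I. y' a b = (\<Sum>z\<in>X. of_real (w z) * cnj (mpow z a) * mpow z b)"
        "\<forall>z\<in>X. \<exists>q. \<forall>z'\<in>X. peval ?J q z' = (if z' = z then 1 else 0)"
      show thesis
        by (rule that[OF *(1) bspec[OF *(2)] bspec[OF bspec[OF *(3)]] bspec[OF *(4)]])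
    qed
    have peval_J: "peval ?J u z = peval ?I u z" for z
      unfolding peval_def using JI u by (intro sum.mono_neutral_left) auto
    \<comment> \<open>\<open>u\<close> is isotropic for \<open>y'\<close>, and the positive weights
      turn this into a vanishing sum of nonnegative terms.\<close>
    have uX: "peval ?I u z = 0" if z: "z \<in> X" for z
    proof -
      have "0 = mform ?I y' u u"
        unfolding mform_row using Mu' by simp
      also have "\<dots> = (\<Sum>z\<in>X. of_real (w z) * cnj (peval ?I u z) * peval ?I u z)"
        by (rule atomic_form[OF y'])
      also have "\<dots> = (\<Sum>z\<in>X. of_real (w z * (cmod (peval ?I u z))\<^sup>2))"
        by (intro sum.cong refl) (simp only: of_real_mult complex_norm_square mult_ac)
      also have "\<dots> = of_real (\<Sum>z\<in>X. w z * (cmod (peval ?I u z))\<^sup>2)"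
        by (rule of_real_sum[symmetric])
      finally have "(\<Sum>z\<in>X. w z * (cmod (peval ?I u z))\<^sup>2) = 0"
        by (metis of_real_eq_0_iff)
      moreover have "w z * (cmod (peval ?I u z))\<^sup>2 \<ge> 0" if "z \<in> X" for z
        using w[OF that] by simp
      ultimately have "w z * (cmod (peval ?I u z))\<^sup>2 = 0"
        using sum_nonneg_eq_0_iff[OF X, of "\<lambda>z. w z * (cmod (peval ?I u z))\<^sup>2"] z by blast
      then show ?thesis using w[OF z] by simp
    qed
    have xX: "x \<notin> X" using uX[of x] ux s by auto
    define w' where "w' = w(x := inverse s)"
    show ?thesis
    proof (intro exI[of _ "insert x X"] exI[of _ w'] conjI ballI)
      show "finite (insert x X)" using X by simp
      show "w' z > 0" if "z \<in> insert x X" for z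
        using that w s by (auto simp: w'_def)
    next
      fix a b assume ab: "a \<in> ?I" "b \<in> ?I"
      have "y a b = inverse (of_real s) * mpow x a * mpow x b + y' a b" by (simp add: y'_def)
      also have "y' a b = (\<Sum>z\<in>X. of_real (w' z) * cnj (mpow z a) * mpow z b)"
        unfolding y'[OF ab] using xX by (intro sum.cong refl) (auto simp: w'_def)
      finally show "y a b = (\<Sum>z\<in>insert x X. of_real (w' z) * cnj (mpow z a) * mpow z b)"
        using X xX by (simp add: real_x w'_def)
    next
      \<comment> \<open>Divided by \<open>s\<close>, the polynomial \<open>u\<close> is the
        interpolant of the new atom. The old interpolants are corrected at \<open>x\<close> by
        multiples of \<open>u\<close>, which leaves their values on \<open>X\<close>
        unchanged.\<close>
      fix z assume z: "z \<in> insert x X"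
      show "\<exists>q. \<forall>z'\<in>insert x X. peval ?J q z' = (if z' = z then 1 else 0)"
      proof (cases "z = x")
        case True
        have "peval ?J (\<lambda>b. 0 + inverse (of_real s) * u b) z' = (if z' = z then 1 else 0)"
          if "z' \<in> insert x X" for z'
          unfolding peval_axpy peval_J using that True ux uX s xX by (auto simp: peval_def)
        then show ?thesis by blast
      next
        case False
        then obtain q where q: "\<And>z'. z' \<in> X \<Longrightarrow> peval ?J q z' = (if z' = z then 1 else 0)"
          using dual[of z] z by blast
        have "peval ?J (\<lambda>b. q b + (- peval ?J q x / of_real s) * u b) z' = (if z' = z then 1 else 0)"
          if "z' \<in> insert x X" for z'
          unfolding peval_axpy peval_J using that False ux uX s xX q by auto
        then show ?thesis by blast
      qed
    qed
  qed
qed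

section \<open>Atomic measures and their moment matrices\<close>

lemma mat_psd_atomic:
  assumes "\<And>a b. a \<in> I \<Longrightarrow> b \<in> I \<Longrightarrow> A a b = (\<Sum>x\<in>X. of_real (c x) * cnj (mpow x a) * mpow x b)"
    and "\<And>x. x \<in> X \<Longrightarrow> c x \<ge> 0"
  shows "mat_psd I A"
  unfolding mat_psd_def mform_def[symmetric]
proof (intro conjI ballI allI)
  fix a b assume "a \<in> I" "b \<in> I"
  then show "A b a = cnj (A a b)"
    by (simp add: assms(1) cnj_sum mult_ac)
next
  fix v
  have "mform I A v v = (\<Sum>x\<in>X. of_real (c x) * cnj (peval I v x) * peval I v x)"
    by (rule atomic_form[OF assms(1)])
  also have "\<dots> = (\<Sum>x\<in>X. of_real (c x * (cmod (peval I v x))\<^sup>2))"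
    by (intro sum.cong refl) (simp only: of_real_mult complex_norm_square mult_ac)
  finally have "Re (mform I A v v) = (\<Sum>x\<in>X. c x * (cmod (peval I v x))\<^sup>2)"
    by (simp only: Re_sum Re_complex_of_real)
  then show "Re (mform I A v v) \<ge> 0"
    using assms(2) by (simp add: sum_nonneg)
qed

lemma atomic_columns:
  assumes "\<And>a b. a \<in> I \<Longrightarrow> b \<in> I \<Longrightarrow> A a b = (\<Sum>x\<in>X. c x * cnj (mpow x a) * mpow x b)"
  shows "matcol I A ` I \<subseteq> cfun.span ((\<lambda>x a. if a \<in> I then cnj (mpow x a) else 0) ` X)"
proof (rule image_subsetI)
  fix b assume b: "b \<in> I"
  have "matcol I A b = (\<lambda>a. \<Sum>x\<in>X. (c x * mpow x b) * (if a \<in> I then cnj (mpow x a) else 0))"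
    using assms[OF _ b] by (auto simp: matcol_def fun_eq_iff mult_ac intro!: sum.cong)
  also have "\<dots> \<in> cfun.span ((\<lambda>x a. if a \<in> I then cnj (mpow x a) else 0) ` X)"
    by (rule cfun_sum_in_span) (rule cfun.span_base, rule imageI)
  finally show "matcol I A b \<in> cfun.span ((\<lambda>x a. if a \<in> I then cnj (mpow x a) else 0) ` X)" .
qed

text \<open>Rank \<open>card X\<close> makes the evaluation vectors at \<open>X\<close> a basis of
  the column space. Writing the one at \<open>x\<close> as the image of some \<open>q\<close> and
  comparing coefficients gives \<open>c z * peval I q z\<close> equal to 1 at \<open>x\<close> and 0
  elsewhere on \<open>X\<close>, so \<open>q\<close> only has to be rescaled.\<close>

lemma interpolation_of_rank:
  assumes fin: "finite I" "finite X"
    and A: "\<And>a b. a \<in> I \<Longrightarrow> b \<in> I \<Longrightarrow> A a b = (\<Sum>x\<in>X. c x * cnj (mpow x a) * mpow x b)"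
    and rank: "mat_rank I A = card X"
    and x: "x \<in> X"
  shows "\<exists>q. \<forall>z\<in>X. peval I q z = (if z = x then 1 else 0)"
proof -
  define V where "V = (\<lambda>x a. if a \<in> I then cnj (mpow x a) else 0)"
  have cols: "matcol I A ` I \<subseteq> cfun.span (V ` X)"
    unfolding V_def by (rule atomic_columns[OF A])
  obtain D where D: "D \<subseteq> V ` X" "cfun.independent D" "V ` X \<subseteq> cfun.span D"
      "card D = cfun.dim (V ` X)"
    by (rule cfun.basis_exists)
  have finV: "finite (V ` X)" using fin(2) by simp
  have "card X \<le> cfun.dim (V ` X)"
    unfolding rank[symmetric] mat_rank_matcol
    by (rule cfun_dim_mono[OF finV cfun.span_superset cols])
  then have cD: "card X \<le> card D" using D(4) by simp
  have "card D \<le> card (V ` X)" using D(1) finV card_mono by blast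
  then have cV: "card (V ` X) = card X" and "card (V ` X) \<le> card D"
    using cD card_image_le[OF fin(2), of V] by simp_all
  then have "D = V ` X" using card_seteq[OF finV D(1)] by simp
  then have ind: "cfun.independent (V ` X)" using D(2) by simp
  have inj: "inj_on V X" by (rule eq_card_imp_inj_on[OF fin(2) cV])
  have "cfun.span (V ` X) \<subseteq> cfun.span (matcol I A ` I)"
    using cfun.dim_le_card'[OF finV] cV rank
    by (intro cfun_span_eq_of_dim_le[OF finV order_refl cols]) (simp add: mat_rank_matcol)
  moreover have "V x \<in> cfun.span (V ` X)"
    using x by (simp add: cfun.span_base)
  ultimately have "V x \<in> cfun.span (matcol I A ` I)" by blast
  then obtain q where q: "\<And>a. a \<in> I \<Longrightarrow> V x a = (\<Sum>b\<in>I. A a b * q b)"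
    by (rule matcol_span_coeffs[OF _ fin(1) order_refl]) blast
  \<comment> \<open>The coefficient of \<open>V z\<close> in the image of \<open>q\<close> minus
    \<open>V x\<close>.\<close>
  define k where "k z = c z * peval I q z - (if z = x then 1 else 0)" for z
  have "(\<Sum>z\<in>X. (\<lambda>a. k z * V z a)) = 0"
  proof (rule ext)
    fix a
    have "(\<Sum>z\<in>X. (\<lambda>a. k z * V z a)) a = (\<Sum>z\<in>X. k z * V z a)"
      using fin(2) by induction simp_all
    also have "\<dots> = (\<Sum>z\<in>X. c z * peval I q z * V z a - (if z = x then V z a else 0))"
      by (intro sum.cong refl) (simp add: k_def left_diff_distrib)
    also have "\<dots> = (\<Sum>z\<in>X. c z * peval I q z * V z a) - V x a"
      using fin(2) x by (simp add: sum_subtractf)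
    also have "\<dots> = 0"
    proof (cases "a \<in> I")
      case True
      have "V x a = (\<Sum>z\<in>X. c z * peval I q z * cnj (mpow z a))"
        unfolding q[OF True] by (rule atomic_row[OF A True])
      then show ?thesis using True by (simp add: V_def)
    qed (simp add: V_def)
    finally show "(\<Sum>z\<in>X. (\<lambda>a. k z * V z a)) a = 0 a" by simp
  qed
  then have sum0: "(\<Sum>v\<in>V ` X. (\<lambda>a. k (inv_into X V v) * v a)) = 0"
    by (simp add: sum.reindex[OF inj] inv_into_f_f[OF inj])
  have k0: "k z = 0" if "z \<in> X" for z
    using cfun.independentD[OF ind finV order_refl sum0, of "V z"] that
    by (simp add: inv_into_f_f[OF inj])
  have "c x \<noteq> 0" using k0[OF x] by (auto simp: k_def)
  have "peval I (\<lambda>b. 0 + c x * q b) z = (if z = x then 1 else 0)" if "z \<in> X" for z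
  proof (cases "z = x")
    case True
    then show ?thesis unfolding peval_axpy using k0[OF x] by (simp add: k_def peval_def)
  next
    case False
    have "c z * peval I q z = 0" using k0[OF that] False by (simp add: k_def)
    \<comment> \<open>A point of weight zero could be dropped, and fewer than \<open>card X\<close>
      evaluation vectors would span the columns.\<close>
    moreover have "c z \<noteq> 0"
    proof
      assume cz: "c z = 0"
      have "matcol I A ` I \<subseteq> cfun.span (V ` (X - {z}))"
      proof -
        have "A a b = (\<Sum>x\<in>X - {z}. c x * cnj (mpow x a) * mpow x b)" if "a \<in> I" "b \<in> I" for a b
          unfolding A[OF that] using fin(2) cz by (intro sum.mono_neutral_right) auto
        then show ?thesis unfolding V_def by (rule atomic_columns)
      qed
      then have "mat_rank I A \<le> card (V ` (X - {z}))"
        unfolding mat_rank_matcol using fin(2) by (intro cfun.dim_le_card) auto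
      also have "\<dots> \<le> card (X - {z})" using fin(2) by (intro card_image_le) simp
      also have "\<dots> < card X" using fin(2) that by (rule card_Diff1_less)
      finally show False using rank by simp
    qed
    ultimately show ?thesis
      unfolding peval_axpy using False by (simp add: peval_def)
  qed
  then show ?thesis by blast
qed

text \<open>The interpolation polynomials are dual to the evaluation vectors, which are hence
  independent; division by a nonzero weight puts such a vector into the column space. Weights may
  vanish, which is how zeros of a localizing polynomial get counted.\<close>

lemma rank_of_interpolation:
  assumes fin: "finite I" "finite X"
    and A: "\<And>a b. a \<in> I \<Longrightarrow> b \<in> I \<Longrightarrow> A a b = (\<Sum>x\<in>X. c x * cnj (mpow x a) * mpow x b)"
    and dual: "\<And>x. x \<in> X \<Longrightarrow> \<exists>q. \<forall>z\<in>X. peval I q z = (if z = x then 1 else 0)"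
  shows "mat_rank I A = card {x \<in> X. c x \<noteq> 0}"
proof -
  define V where "V = (\<lambda>x a. if a \<in> I then cnj (mpow x a) else 0)"
  define Y where "Y = {x \<in> X. c x \<noteq> 0}"
  have Y: "Y \<subseteq> X" "finite Y" using fin(2) by (auto simp: Y_def)
  have AY: "A a b = (\<Sum>x\<in>Y. c x * cnj (mpow x a) * mpow x b)" if "a \<in> I" "b \<in> I" for a b
    unfolding A[OF that] Y_def using fin(2) by (intro sum.mono_neutral_right) auto
  obtain q where q: "\<And>x z. x \<in> X \<Longrightarrow> z \<in> X \<Longrightarrow> peval I (q x) z = (if z = x then 1 else 0)"
    using dual by metis
  have pair: "(\<Sum>a\<in>I. cnj (q x a) * V z a) = (if z = x then 1 else 0)" if "x \<in> X" "z \<in> X" for x z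
  proof -
    have "(\<Sum>a\<in>I. cnj (q x a) * V z a) = cnj (peval I (q x) z)"
      unfolding peval_def cnj_sum by (intro sum.cong refl) (simp add: V_def)
    then show ?thesis using q[OF that] by simp
  qed
  have inj: "inj_on V Y"
  proof (rule inj_onI)
    fix x z assume "x \<in> Y" "z \<in> Y" "V x = V z"
    then show "x = z"
      using pair[of x x] pair[of x z] Y(1) by (metis one_neq_zero subsetD)
  qed
  have ind: "cfun.independent (V ` Y)"
  proof
    assume "cfun.dependent (V ` Y)"
    then obtain f where f: "\<exists>v\<in>V ` Y. f v \<noteq> 0" "(\<Sum>v\<in>V ` Y. (\<lambda>a. f v * v a)) = 0"
      using cfun.dependent_finite Y(2) by blast
    then obtain x where x: "x \<in> Y" "f (V x) \<noteq> 0" by blast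
    have *: "(\<Sum>z\<in>Y. f (V z) * V z a) = 0" for a
    proof -
      have "(\<Sum>z\<in>Y. (\<lambda>a. f (V z) * V z a)) a = (\<Sum>z\<in>Y. f (V z) * V z a)"
        using Y(2) by induction simp_all
      then show ?thesis using f(2) by (simp add: sum.reindex[OF inj])
    qed
    \<comment> \<open>Pairing the dependency with \<open>q x\<close> isolates the coefficient of
      \<open>V x\<close>.\<close>
    have "0 = (\<Sum>a\<in>I. cnj (q x a) * (\<Sum>z\<in>Y. f (V z) * V z a))"
      unfolding * by simp
    also have "\<dots> = (\<Sum>a\<in>I. \<Sum>z\<in>Y. f (V z) * (cnj (q x a) * V z a))"
      by (simp add: sum_distrib_left mult.left_commute)
    also have "\<dots> = (\<Sum>z\<in>Y. \<Sum>a\<in>I. f (V z) * (cnj (q x a) * V z a))"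
      by (rule sum.swap)
    also have "\<dots> = (\<Sum>z\<in>Y. f (V z) * (if z = x then 1 else 0))"
      unfolding sum_distrib_left[symmetric]
    proof (intro sum.cong refl)
      fix z assume z: "z \<in> Y"
      show "f (V z) * (\<Sum>a\<in>I. cnj (q x a) * V z a) = f (V z) * (if z = x then 1 else 0)"
        unfolding pair[OF subsetD[OF Y(1) x(1)] subsetD[OF Y(1) z]] ..
    qed
    also have "\<dots> = f (V x)"
      using Y(2) x(1) by (simp add: if_distrib cong: if_cong)
    finally show False using x(2) by simp
  qed
  have "V ` Y \<subseteq> cfun.span (matcol I A ` I)"
  proof (rule image_subsetI)
    fix x assume x: "x \<in> Y"
    have "V x = (\<lambda>a. \<Sum>b\<in>I. (q x b / c x) * matcol I A b a)"
    proof (rule ext)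
      fix a
      show "V x a = (\<Sum>b\<in>I. (q x b / c x) * matcol I A b a)"
      proof (cases "a \<in> I")
        case True
        have "(\<Sum>b\<in>I. (q x b / c x) * matcol I A b a) = (\<Sum>b\<in>I. A a b * q x b) / c x"
          using True by (simp add: matcol_def sum_divide_distrib mult.commute)
        also have "(\<Sum>b\<in>I. A a b * q x b) = (\<Sum>z\<in>X. c z * peval I (q x) z * cnj (mpow z a))"
          by (rule atomic_row[OF A True])
        also have "\<dots> = (\<Sum>z\<in>X. if z = x then c x * cnj (mpow x a) else 0)"
          using q x Y(1) by (intro sum.cong refl) (auto simp: subset_iff)
        also have "\<dots> = c x * cnj (mpow x a)"
          using fin(2) x Y(1) by auto
        finally show ?thesis using x True by (simp add: V_def Y_def)
      qed (simp add: V_def matcol_def)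
    qed
    also have "\<dots> \<in> cfun.span (matcol I A ` I)"
      by (rule cfun_sum_in_span) (rule cfun.span_base, rule imageI)
    finally show "V x \<in> cfun.span (matcol I A ` I)" .
  qed
  moreover have "matcol I A ` I \<subseteq> cfun.span (V ` Y)"
    unfolding V_def by (rule atomic_columns[OF AY])
  ultimately have "cfun.span (matcol I A ` I) = cfun.span (V ` Y)"
    unfolding cfun.span_eq by blast
  then have "mat_rank I A = cfun.dim (V ` Y)"
    unfolding mat_rank_matcol by (rule cfun.span_eq_dim)
  also have "\<dots> = card Y"
    using cfun.dim_eq_card_independent[OF ind] card_image[OF inj] by simp
  finally show ?thesis by (simp add: Y_def)
qed

section \<open>Finitely atomic measures\<close>

text \<open>The push-forward along the identity trades the sigma-algebra of all subsets of
  \<open>X\<close> for the Borel sets of the whole space.\<close>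

definition atomic_on :: "'a::topological_space set \<Rightarrow> ('a \<Rightarrow> real) \<Rightarrow> 'a measure" where
  "atomic_on X w = distr (point_measure X (\<lambda>x. ennreal (w x))) borel (\<lambda>x. x)"

lemma sets_atomic_on [simp]: "sets (atomic_on X w) = sets borel"
  by (simp add: atomic_on_def)

lemma emeasure_atomic_on:
  assumes "finite X" "A \<in> sets borel"
  shows "emeasure (atomic_on X w) A = (\<Sum>x\<in>X. ennreal (w x) * indicator A x)"
proof -
  have "emeasure (atomic_on X w) A = emeasure (point_measure X (\<lambda>x. ennreal (w x))) (A \<inter> X)"
    unfolding atomic_on_def using assms(2)
    by (subst emeasure_distr) (simp_all add: space_point_measure)
  also have "\<dots> = (\<Sum>x\<in>A \<inter> X. ennreal (w x))"
    using assms(1) by (simp add: emeasure_point_measure_finite)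
  also have "\<dots> = (\<Sum>x\<in>X. ennreal (w x) * indicator A x)"
    using assms(1) by (intro sum.mono_neutral_cong_left) (auto simp: indicator_def)
  finally show ?thesis .
qed

text \<open>Injectivity of the enumeration makes the weight a function of the point, so the atoms
  can be handled as a set.\<close>

lemma atomic_measure_iff:
  "atomic_measure r \<mu> \<longleftrightarrow>
    (\<exists>X w. finite X \<and> card X = r \<and> (\<forall>x\<in>X. w x > 0) \<and> \<mu> = atomic_on X w)"
proof
  assume "atomic_measure r \<mu>"
  then obtain w x where sets: "sets \<mu> = sets borel" and w: "\<And>j. j < r \<Longrightarrow> w j > 0"
    and inj: "inj_on x {..<r}"
    and em: "\<And>A. A \<in> sets borel \<Longrightarrow>
      emeasure \<mu> A = (\<Sum>j<r. ennreal (w j) * emeasure (return borel (x j)) A)"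
    unfolding atomic_measure_def by blast
  define X where "X = x ` {..<r}"
  define w' where "w' = w \<circ> inv_into {..<r} x"
  have w': "w' (x j) = w j" if "j < r" for j
    using inj that by (simp add: w'_def)
  have "\<mu> = atomic_on X w'"
  proof (rule measure_eqI)
    fix A assume "A \<in> sets \<mu>"
    then have A: "A \<in> sets borel" using sets by simp
    have "emeasure (atomic_on X w') A = (\<Sum>j<r. ennreal (w' (x j)) * indicator A (x j))"
      using A by (simp add: emeasure_atomic_on X_def sum.reindex[OF inj])
    also have "\<dots> = emeasure \<mu> A"
      unfolding em[OF A] using A w' by (intro sum.cong) simp_all
    finally show "emeasure \<mu> A = emeasure (atomic_on X w') A" ..
  qed (simp add: sets)
  moreover have "finite X" "card X = r" "\<forall>x\<in>X. w' x > 0"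
    using w w' by (auto simp: X_def card_image[OF inj])
  ultimately show "\<exists>X w. finite X \<and> card X = r \<and> (\<forall>x\<in>X. w x > 0) \<and> \<mu> = atomic_on X w"
    by blast
next
  assume "\<exists>X w. finite X \<and> card X = r \<and> (\<forall>x\<in>X. w x > 0) \<and> \<mu> = atomic_on X w"
  then obtain X w where X: "finite X" "card X = r" and w: "\<And>x. x \<in> X \<Longrightarrow> w x > 0"
    and \<mu>: "\<mu> = atomic_on X w" by blast
  obtain x where "bij_betw x {0..<card X} X" using ex_bij_betw_nat_finite[OF X(1)] by blast
  then have bij: "bij_betw x {..<r} X" using X(2) by (simp add: atLeast0LessThan)
  show "atomic_measure r \<mu>"
    unfolding atomic_measure_def
  proof (intro conjI exI[of _ "w \<circ> x"] exI[of _ x] allI impI ballI)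
    show "inj_on x {..<r}" using bij by (rule bij_betw_imp_inj_on)
    show "(w \<circ> x) j > 0" if "j < r" for j
      using w[of "x j"] bij_betwE[OF bij] that by simp
    fix A :: "'a set" assume A: "A \<in> sets borel"
    have "emeasure \<mu> A = (\<Sum>j<r. ennreal (w (x j)) * indicator A (x j))"
      unfolding \<mu> emeasure_atomic_on[OF X(1) A] by (rule sum.reindex_bij_betw[OF bij, symmetric])
    then show "emeasure \<mu> A = (\<Sum>j<r. ennreal ((w \<circ> x) j) * emeasure (return borel (x j)) A)"
      using A by simp
  qed (simp add: \<mu>)
qed

lemma atoms_atomic_on:
  fixes X :: "'a::t1_space set"
  assumes "finite X" "\<And>x. x \<in> X \<Longrightarrow> w x > 0"
  shows "atoms (atomic_on X w) = X"
proof -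
  have "emeasure (atomic_on X w) {x} = (if x \<in> X then ennreal (w x) else 0)" for x
  proof -
    have "emeasure (atomic_on X w) {x} = (\<Sum>z\<in>X. if z = x then ennreal (w x) else 0)"
      using assms(1) by (subst emeasure_atomic_on) (auto intro!: sum.cong simp: indicator_def)
    then show ?thesis using assms(1) by simp
  qed
  then show ?thesis using assms(2) by (auto simp: atoms_def)
qed

lemma AE_atomic_on:
  assumes "finite X" "\<And>x. x \<in> X \<Longrightarrow> w x > 0" "closed K"
  shows "(AE z in atomic_on X w. z \<in> K) \<longleftrightarrow> X \<subseteq> K"
proof -
  have "(AE z in atomic_on X w. z \<in> K) \<longleftrightarrow> (AE z in point_measure X (\<lambda>x. ennreal (w x)). z \<in> K)"
    unfolding atomic_on_def by (rule AE_distr_iff) (use assms(3) in simp_all)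
  also have "\<dots> \<longleftrightarrow> X \<subseteq> K"
    using assms(2) by (auto simp: AE_point_measure)
  finally show ?thesis .
qed

lemma represents_atomic_on:
  fixes y :: "'n::finite multi \<Rightarrow> 'n multi \<Rightarrow> complex"
  assumes "finite X" "\<And>x. x \<in> X \<Longrightarrow> w x > 0"
  shows "represents (atomic_on X w) d y \<longleftrightarrow>
    (\<forall>a\<in>midx d. \<forall>b\<in>midx d. y a b = (\<Sum>x\<in>X. of_real (w x) * cnj (mpow x a) * mpow x b))"
proof -
  have "(\<integral>z. cnj (mpow z a) * mpow z b \<partial>atomic_on X w)
      = (\<Sum>x\<in>X. of_real (w x) * cnj (mpow x a) * mpow x b)" for a b :: "'n multi"
  proof -
    have "continuous_on UNIV (\<lambda>z :: complex ^ 'n. cnj (mpow z a) * mpow z b)"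
      unfolding mpow_def by (intro continuous_intros)
    then have "(\<lambda>z. cnj (mpow z a) * mpow z b) \<in> borel_measurable borel"
      by (rule borel_measurable_continuous_onI)
    then have "(\<integral>z. cnj (mpow z a) * mpow z b \<partial>atomic_on X w)
        = (\<integral>z. cnj (mpow z a) * mpow z b \<partial>point_measure X (\<lambda>x. ennreal (w x)))"
      unfolding atomic_on_def by (intro integral_distr) simp_all
    also have "\<dots> = (\<Sum>x\<in>X. w x *\<^sub>R (cnj (mpow x a) * mpow x b))"
      using assms by (intro lebesgue_integral_point_measure_finite) (auto intro: less_imp_le)
    finally show ?thesis by (simp add: scaleR_conv_of_real mult.assoc)
  qed
  then show ?thesis by (simp add: represents_def)
qed

text \<open>Localizing multiplies each weight by the value of \<open>\<phi>\<close> at the atom. The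
  bound \<open>t + k \<le> d\<close> keeps all shifted indices where the moments are known.\<close>

lemma localize_atomic:
  assumes y: "\<And>a b. a \<in> midx d \<Longrightarrow> b \<in> midx d \<Longrightarrow> y a b = (\<Sum>x\<in>X. of_real (w x) * cnj (mpow x a) * mpow x b)"
    and keys: "Poly_Mapping.keys \<phi> \<subseteq> midx k \<times> midx k" and le: "t + k \<le> d"
    and ab: "a \<in> midx t" "b \<in> midx t"
  shows "localize \<phi> y a b = (\<Sum>x\<in>X. (of_real (w x) * ceval \<phi> x) * cnj (mpow x a) * mpow x b)"
proof -
  let ?f = "\<lambda>x c e. of_real (w x) * cnj (mpow x a) * mpow x b *
    (Poly_Mapping.lookup \<phi> (c, e) * cnj (mpow x c) * mpow x e)"
  have "localize \<phi> y a b = (\<Sum>(c, e)\<in>Poly_Mapping.keys \<phi>. \<Sum>x\<in>X. ?f x c e)"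
    unfolding localize_def
  proof (intro sum.cong refl, clarify)
    fix c e assume "(c, e) \<in> Poly_Mapping.keys \<phi>"
    then have "a + c \<in> midx d" "b + e \<in> midx d"
      using keys le ab by (auto simp: midx_def mdeg_add)
    then show "Poly_Mapping.lookup \<phi> (c, e) * y (a + c) (b + e) = (\<Sum>x\<in>X. ?f x c e)"
      by (simp add: y mpow_add sum_distrib_left mult_ac)
  qed
  also have "\<dots> = (\<Sum>p\<in>Poly_Mapping.keys \<phi>. \<Sum>x\<in>X. ?f x (fst p) (snd p))"
    by (simp add: case_prod_unfold)
  also have "\<dots> = (\<Sum>x\<in>X. \<Sum>p\<in>Poly_Mapping.keys \<phi>. ?f x (fst p) (snd p))"
    by (rule sum.swap)
  also have "\<dots> = (\<Sum>x\<in>X. (of_real (w x) * ceval \<phi> x) * cnj (mpow x a) * mpow x b)"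
  proof (intro sum.cong refl)
    fix x
    show "(\<Sum>p\<in>Poly_Mapping.keys \<phi>. ?f x (fst p) (snd p))
        = (of_real (w x) * ceval \<phi> x) * cnj (mpow x a) * mpow x b"
      unfolding sum_distrib_left[symmetric] ceval_def case_prod_unfold by (simp add: mult_ac)
  qed
  finally show ?thesis .
qed

section \<open>The flat extension theorem\<close>

lemma interpolation_mono:
  assumes "J \<subseteq> I" "finite I" "\<exists>q. \<forall>z\<in>X. peval J q z = (if z = x then 1 else 0)"
  shows "\<exists>q. \<forall>z\<in>X. peval I q z = (if z = x then 1 else 0)"
proof -
  obtain q where q: "\<And>z. z \<in> X \<Longrightarrow> peval J q z = (if z = x then 1 else 0)"
    using assms(3) by blast
  have "peval I (\<lambda>b. if b \<in> J then q b else 0) z = peval J q z" for z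
    unfolding peval_def using assms(1,2) by (intro sum.mono_neutral_cong_right) auto
  then have "\<forall>z\<in>X. peval I (\<lambda>b. if b \<in> J then q b else 0) z = (if z = x then 1 else 0)"
    using q by simp
  then show ?thesis by blast
qed

text \<open>Serves the degenerate case of constant polynomials: the localizing matrix is a negative
  multiple of the moment matrix. As both are positive semidefinite, every vector is isotropic, and
  the kernel lemma at unit vectors clears the entries.\<close>

lemma moments_zero_of_constant:
  fixes \<phi> :: "'n::finite cpoly" and y :: "'n multi \<Rightarrow> 'n multi \<Rightarrow> complex"
  assumes \<phi>: "\<phi> \<in> real_cpolys 0" and neg: "Re (ceval \<phi> z) < 0"
    and psd: "mat_psd (midx d) y" "mat_psd (midx d) (localize \<phi> y)"
    and ab: "a \<in> midx d" "b \<in> midx d"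
  shows "y a b = 0"
proof -
  have "midx 0 = {0 :: 'n multi}" by (auto simp: midx_def mdeg_eq_0_iff)
  then have keys: "Poly_Mapping.keys \<phi> \<subseteq> {(0, 0)}"
    using \<phi> by (auto simp: real_cpolys_def)
  have collapse: "(\<Sum>p\<in>Poly_Mapping.keys \<phi>. Poly_Mapping.lookup \<phi> p * f p)
      = Poly_Mapping.lookup \<phi> (0, 0) * f (0, 0)" for f
  proof -
    have "(\<Sum>p\<in>Poly_Mapping.keys \<phi>. Poly_Mapping.lookup \<phi> p * f p)
        = (\<Sum>p\<in>{(0, 0)}. Poly_Mapping.lookup \<phi> p * f p)"
      by (intro sum.mono_neutral_left keys) (auto simp: in_keys_iff)
    then show ?thesis by simp
  qed
  define c where "c = ceval \<phi> z"
  have "c = Poly_Mapping.lookup \<phi> (0, 0)"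
    using collapse[of "\<lambda>p. cnj (mpow z (fst p)) * mpow z (snd p)"]
    by (simp add: c_def ceval_def case_prod_unfold mult.assoc)
  then have loc: "localize \<phi> y = (\<lambda>a b. c * y a b)"
    using collapse[of "\<lambda>p. y (_ + fst p) (_ + snd p)"]
    by (simp add: fun_eq_iff localize_def case_prod_unfold)
  have c: "c = of_real (Re c)"
    using \<phi> by (simp add: real_cpolys_def c_def)
  have zero: "mform (midx d) y p p = 0" for p
  proof -
    let ?f = "mform (midx d) y p p"
    have "mform (midx d) (localize \<phi> y) p p = of_real (Re c) * ?f"
      unfolding c[symmetric] loc mform_def sum_distrib_left
      by (intro sum.cong refl) simp
    then have "Re c * Re ?f \<ge> 0"
      using mat_psd_nonneg[OF psd(2), of p] by simp
    then have "Re ?f \<le> 0"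
      using neg by (simp add: c_def zero_le_mult_iff)
    moreover have "Re ?f \<ge> 0" by (rule mat_psd_nonneg[OF psd(1)])
    moreover have "?f \<in> \<real>"
      using mform_cnj[OF psd(1)] by (simp add: Reals_cnj_iff)
    ultimately show ?thesis by (simp add: complex_eq_iff complex_is_Real_iff)
  qed
  have "(\<Sum>e\<in>midx d. y a e * (if e = b then 1 else 0)) = 0"
    by (rule mat_psd_kernel[OF finite_midx psd(1) zero ab(1)])
  then show ?thesis
    using ab(2) by (simp add: if_distrib cong: if_cong)
qed

theorem corollary3p9:
  fixes m d dK :: nat
    and g :: "nat \<Rightarrow> 'n::finite cpoly"
    and k :: "nat \<Rightarrow> nat"
    and y :: "'n multi \<Rightarrow> 'n multi \<Rightarrow> complex"
    and K :: "(complex ^ 'n) set"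
  assumes "m \<ge> 1"
    and "\<And>i. i \<in> {1..m} \<Longrightarrow> has_cdegree (g i) (k i)"
    and "K = feasible_set m g"
    and "compact K"
    and "dK = Max (k ` {1..m})"
    and "d \<ge> dK"
    and "y \<in> herm_families d"
    and "hankel d y"
  shows "((\<exists>\<mu>. atomic_measure (mat_rank (midx (d - dK)) y) \<mu> \<and> (AE z in \<mu>. z \<in> K) \<and> represents \<mu> d y)
      \<longleftrightarrow>
      mat_psd (midx d) y \<and>
      (\<forall>i\<in>{1..m}. mat_psd (midx (d - dK)) (localize (g i) y)) \<and>
      mat_rank (midx d) y = mat_rank (midx (d - dK)) y)
    \<and> (\<forall>\<mu>. atomic_measure (mat_rank (midx (d - dK)) y) \<mu> \<and> (AE z in \<mu>. z \<in> K) \<and> represents \<mu> d y \<longrightarrow>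
        (\<forall>i\<in>{1..m}. int (card {z \<in> atoms \<mu>. ceval (g i) z = 0}) =
           int (mat_rank (midx d) y) - int (mat_rank (midx (d - dK)) (localize (g i) y))))"
proof -
  define t where "t = d - dK"
  let ?I = "midx d :: 'n multi set" and ?J = "midx t :: 'n multi set"
  have JI: "?J \<subseteq> ?I" unfolding t_def by (intro midx_mono) simp
  have kK: "k i \<le> dK" if "i \<in> {1..m}" for i
    using that unfolding assms(5) by (intro Max_ge) auto
  have g_keys: "Poly_Mapping.keys (g i) \<subseteq> midx (k i) \<times> midx (k i)" if "i \<in> {1..m}" for i
    using assms(2)[OF that] by (simp add: has_cdegree_def real_cpolys_def)
  have g_real: "ceval (g i) z = of_real (Re (ceval (g i) z))" if "i \<in> {1..m}" for i z
    using assms(2)[OF that] by (simp add: has_cdegree_def real_cpolys_def)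
  have g_loc: "localize (g i) y a b
      = (\<Sum>x\<in>X. (of_real (w x) * ceval (g i) x) * cnj (mpow x a) * mpow x b)"
    if "i \<in> {1..m}" "a \<in> ?J" "b \<in> ?J"
      "\<And>a b. a \<in> ?I \<Longrightarrow> b \<in> ?I \<Longrightarrow> y a b = (\<Sum>x\<in>X. of_real (w x) * cnj (mpow x a) * mpow x b)"
    for i a b X w
    using kK[OF that(1)] assms(6)
    by (intro localize_atomic[OF that(4) g_keys[OF that(1)] _ that(2,3)]) (auto simp: t_def)
  have clK: "closed K" using assms(4) by (rule compact_imp_closed)
  \<comment> \<open>Necessity and the count of zeros are proved together, since both start from an
    arbitrary representing measure.\<close>
  have conditions: "mat_psd ?I y \<and> (\<forall>i\<in>{1..m}. mat_psd ?J (localize (g i) y)) \<and>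
      mat_rank ?I y = mat_rank ?J y \<and>
      (\<forall>i\<in>{1..m}. int (card {z \<in> atoms \<mu>. ceval (g i) z = 0}) =
           int (mat_rank ?I y) - int (mat_rank ?J (localize (g i) y)))"
    if \<mu>: "atomic_measure (mat_rank ?J y) \<mu>" "AE z in \<mu>. z \<in> K" "represents \<mu> d y" for \<mu>
  proof -
    obtain X w where X: "finite X" "card X = mat_rank ?J y" and w: "\<And>x. x \<in> X \<Longrightarrow> w x > 0"
      and \<mu>_eq: "\<mu> = atomic_on X w"
      using \<mu>(1) unfolding atomic_measure_iff by blast
    have XK: "X \<subseteq> K"
      using \<mu>(2) AE_atomic_on[where w = w, OF X(1) w clK] unfolding \<mu>_eq by blast
    have y: "y a b = (\<Sum>x\<in>X. of_real (w x) * cnj (mpow x a) * mpow x b)"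
      if "a \<in> ?I" "b \<in> ?I" for a b
      using \<mu>(3) represents_atomic_on[where w = w, OF X(1) w] that unfolding \<mu>_eq by blast
    \<comment> \<open>The number of atoms is the rank of the truncated matrix by hypothesis, so
      interpolation is possible already in degree \<open>t\<close>.\<close>
    have dual: "\<exists>q. \<forall>z\<in>X. peval ?J q z = (if z = x then 1 else 0)" if "x \<in> X" for x
      using y JI X that by (intro interpolation_of_rank[where A = y and c = "\<lambda>x. of_real (w x)"]) auto
    \<comment> \<open>Padded to degree \<open>d\<close>, the same polynomials yield the rank of the
      full matrix, hence flatness.\<close>
    have "mat_rank ?I y = card {x \<in> X. complex_of_real (w x) \<noteq> 0}"
      by (rule rank_of_interpolation[OF finite_midx X(1) y interpolation_mono[OF JI finite_midx dual]])
    also have "{x \<in> X. complex_of_real (w x) \<noteq> 0} = X" using w by force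
    finally have rank: "mat_rank ?I y = card X" .
    have psd: "mat_psd ?I y"
      using w by (intro mat_psd_atomic[OF y]) (auto intro: less_imp_le)
    \<comment> \<open>Real-valuedness of \<open>g i\<close> turns the weights into the real numbers
      that \<open>mat_psd_atomic\<close> expects; they are nonnegative because the atoms lie in
      \<open>K\<close>.\<close>
    have psd_g: "mat_psd ?J (localize (g i) y)" if i: "i \<in> {1..m}" for i
    proof (rule mat_psd_atomic)
      fix a b assume "a \<in> ?J" "b \<in> ?J"
      then show "localize (g i) y a b
          = (\<Sum>x\<in>X. of_real (w x * Re (ceval (g i) x)) * cnj (mpow x a) * mpow x b)"
        unfolding of_real_mult g_real[OF i, symmetric] by (rule g_loc[OF i _ _ y])
    next
      fix x assume "x \<in> X"
      then show "w x * Re (ceval (g i) x) \<ge> 0"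
        using w XK i unfolding assms(3) feasible_set_def
        by (intro mult_nonneg_nonneg) (auto intro: less_imp_le)
    qed
    have count: "int (card {z \<in> atoms \<mu>. ceval (g i) z = 0}) =
        int (mat_rank ?I y) - int (mat_rank ?J (localize (g i) y))" if i: "i \<in> {1..m}" for i
    proof -
      have "mat_rank ?J (localize (g i) y) = card {x \<in> X. of_real (w x) * ceval (g i) x \<noteq> 0}"
        by (rule rank_of_interpolation[OF finite_midx X(1) g_loc[OF i _ _ y] dual])
      also have "{x \<in> X. of_real (w x) * ceval (g i) x \<noteq> 0} = X - {z \<in> X. ceval (g i) z = 0}"
        using w by force
      also have "card \<dots> = card X - card {z \<in> X. ceval (g i) z = 0}"
        using X(1) by (intro card_Diff_subset) auto
      finally have "mat_rank ?J (localize (g i) y) = card X - card {z \<in> X. ceval (g i) z = 0}" .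
      moreover have "card {z \<in> X. ceval (g i) z = 0} \<le> card X"
        using X(1) by (intro card_mono) auto
      moreover have "atoms \<mu> = X" unfolding \<mu>_eq by (rule atoms_atomic_on[where w = w, OF X(1) w])
      ultimately show ?thesis using rank by simp
    qed
    show ?thesis using psd psd_g count rank X(2) by simp
  qed
  have existence: "\<exists>\<mu>. atomic_measure (mat_rank ?J y) \<mu> \<and> (AE z in \<mu>. z \<in> K) \<and> represents \<mu> d y"
    if psd: "mat_psd ?I y" and psd_g: "\<And>i. i \<in> {1..m} \<Longrightarrow> mat_psd ?J (localize (g i) y)"
      and rank: "mat_rank ?I y = mat_rank ?J y"
  proof -
    have "\<exists>X w. finite X \<and> (\<forall>x\<in>X. w x > (0::real)) \<and>
      (\<forall>a\<in>?I. \<forall>b\<in>?I. y a b = (\<Sum>x\<in>X. of_real (w x) * cnj (mpow x a) * mpow x b)) \<and>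
      (\<forall>x\<in>X. \<exists>q. \<forall>z\<in>X. peval ?J q z = (if z = x then 1 else 0))"
    proof (cases "dK = 0")
      case False
      \<comment> \<open>A positive \<open>dK\<close> provides the room for the shifts.\<close>
      then have "t < d" using assms(6) by (simp add: t_def)
      then show ?thesis
        by (rule hankel_flat_decomposition[OF _ psd assms(8) flat_columns[OF finite_midx JI rank]])
    next
      \<comment> \<open>Here every \<open>g i\<close> is constant, so the compact set \<open>K\<close> is empty.\<close>
      case True
      have "K \<noteq> UNIV"
        using assms(4) compact_imp_bounded not_bounded_UNIV by metis
      then obtain z where "z \<notin> K" by blast
      then obtain i where i: "i \<in> {1..m}" and neg: "Re (ceval (g i) z) < 0"
        unfolding assms(3) feasible_set_def mem_Collect_eq ball_simps not_le by blast
      have "k i = 0" using kK[OF i] True by simp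
      then have "g i \<in> real_cpolys 0" using assms(2)[OF i] by (simp add: has_cdegree_def)
      \<comment> \<open>With \<open>dK = 0\<close> the two truncation orders coincide, so the
        localizing condition covers all of \<open>?I\<close>.\<close>
      moreover have "mat_psd ?I (localize (g i) y)"
        using psd_g[OF i] True by (simp add: t_def)
      ultimately have "y a b = 0" if "a \<in> ?I" "b \<in> ?I" for a b
        using moments_zero_of_constant[OF _ neg psd _ that] by blast
      then show ?thesis by (intro exI[of _ "{}"]) simp
    qed
    then obtain X w where X: "finite X" and w: "\<And>x. x \<in> X \<Longrightarrow> w x > (0::real)"
      and y: "\<And>a b. a \<in> ?I \<Longrightarrow> b \<in> ?I \<Longrightarrow> y a b = (\<Sum>x\<in>X. of_real (w x) * cnj (mpow x a) * mpow x b)"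
      and dual: "\<And>x. x \<in> X \<Longrightarrow> \<exists>q. \<forall>z\<in>X. peval ?J q z = (if z = x then 1 else 0)"
    proof (elim exE conjE)
      fix X w
      assume *: "finite X" "\<forall>x\<in>X. w x > (0::real)"
        "\<forall>a\<in>?I. \<forall>b\<in>?I. y a b = (\<Sum>x\<in>X. of_real (w x) * cnj (mpow x a) * mpow x b)"
        "\<forall>x\<in>X. \<exists>q. \<forall>z\<in>X. peval ?J q z = (if z = x then 1 else 0)"
      show thesis
        by (rule that[OF *(1) bspec[OF *(2)] bspec[OF bspec[OF *(3)]] bspec[OF *(4)]])
    qed
    \<comment> \<open>The decomposition does not say how many atoms it produces; interpolation in
      degree \<open>t\<close> identifies their number with the rank.\<close>
    have "mat_rank ?J y = card {x \<in> X. complex_of_real (w x) \<noteq> 0}"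
      using y JI by (intro rank_of_interpolation[OF finite_midx X _ dual]) auto
    also have "{x \<in> X. complex_of_real (w x) \<noteq> 0} = X" using w by force
    finally have "atomic_measure (mat_rank ?J y) (atomic_on X w)"
      using X w unfolding atomic_measure_iff by metis
    moreover have "represents (atomic_on X w) d y"
      using y represents_atomic_on[where w = w, OF X w] by blast
    moreover have "X \<subseteq> K"
    proof
      fix x assume x: "x \<in> X"
      obtain q where q: "\<And>z. z \<in> X \<Longrightarrow> peval ?J q z = (if z = x then 1 else 0)"
        using dual[OF x] by blast
      have "Re (ceval (g i) x) \<ge> 0" if i: "i \<in> {1..m}" for i
      proof -
        \<comment> \<open>The interpolant of \<open>x\<close> vanishes at every other atom, so only
          the weight at \<open>x\<close> times the value of \<open>g i\<close> there
          remains.\<close>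
        have "mform ?J (localize (g i) y) q q
            = (\<Sum>z\<in>X. (of_real (w z) * ceval (g i) z) * cnj (peval ?J q z) * peval ?J q z)"
          by (rule atomic_form[OF g_loc[OF i _ _ y]])
        also have "\<dots> = (\<Sum>z\<in>X. if z = x then of_real (w x) * ceval (g i) x else 0)"
          using q by (intro sum.cong) auto
        also have "\<dots> = of_real (w x) * ceval (g i) x"
          using X x by simp
        finally have "w x * Re (ceval (g i) x) \<ge> 0"
          using mat_psd_nonneg[OF psd_g[OF i], of q] by simp
        then show ?thesis using w[OF x] by (simp add: zero_le_mult_iff)
      qed
      then show "x \<in> K" unfolding assms(3) feasible_set_def by simp
    qed
    then have "AE z in atomic_on X w. z \<in> K"
      using AE_atomic_on[where w = w, OF X w clK] by blast
    ultimately show ?thesis by blast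
  qed
  show ?thesis
    unfolding t_def[symmetric] using conditions existence by meson
qed

end
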